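(* For each of the groups $\mathbb{Z}/15\mathbb{Z}\oplus\mathbb{Z}$, $\mathbb{Z}/18\mathbb{Z}\oplus\mathbb{Z}^2$, $\mathbb{Z}/2\mathbb{Z}\oplus\mathbb{Z}/10\mathbb{Z}\oplus\mathbb{Z}^4$, and $\mathbb{Z}/2\mathbb{Z}\oplus\mathbb{Z}/12\mathbb{Z}\oplus\mathbb{Z}^4$, there exist a quadratic number field $K$ and an elliptic curve $E$ over $K$ whose Mordell--Weil group $E(K)$ contains a subgroup isomorphic to that group. *)

theory Defs
  imports
    Complex_Main
    "HOL-Algebra.Algebraic_Closure_Type"
    "HOL-Algebra.Elementary_Groups"
    "HOL-Algebra.Product_Groups"
begin

text \<open>
  Every number field embeds into the complex numbers, so number fields are taken to be subfields
  of \<^typ>\<open>complex\<close>; \<^const>\<open>ring_of_type_algebra\<close> is the type viewed as a ring record.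
\<close>

definition quadratic_number_field :: "complex set \<Rightarrow> bool" where
  "quadratic_number_field K \<longleftrightarrow>
     subfield K ring_of_type_algebra \<and> ring.dimension ring_of_type_algebra 2 \<rat> K"

text \<open>
  The Weierstrass equation
  \<open>y\<^sup>2 + a\<^sub>1 x y + a\<^sub>3 y = x\<^sup>3 + a\<^sub>2 x\<^sup>2 + a\<^sub>4 x + a\<^sub>6\<close>
  is represented by its coefficients.
\<close>

datatype 'a weierstrass =
  Weierstrass (a\<^sub>1: 'a) (a\<^sub>2: 'a) (a\<^sub>3: 'a) (a\<^sub>4: 'a) (a\<^sub>6: 'a)

definition discriminant :: "'a::field weierstrass \<Rightarrow> 'a" where
  "discriminant E =
     (let b\<^sub>2 = (a\<^sub>1 E)\<^sup>2 + 4 * a\<^sub>2 E;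
          b\<^sub>4 = 2 * a\<^sub>4 E + a\<^sub>1 E * a\<^sub>3 E;
          b\<^sub>6 = (a\<^sub>3 E)\<^sup>2 + 4 * a\<^sub>6 E;
          b\<^sub>8 = (a\<^sub>1 E)\<^sup>2 * a\<^sub>6 E + 4 * a\<^sub>2 E * a\<^sub>6 E - a\<^sub>1 E * a\<^sub>3 E * a\<^sub>4 E
                + a\<^sub>2 E * (a\<^sub>3 E)\<^sup>2 - (a\<^sub>4 E)\<^sup>2
      in - (b\<^sub>2\<^sup>2 * b\<^sub>8) - 8 * b\<^sub>4 ^ 3 - 27 * b\<^sub>6\<^sup>2 + 9 * b\<^sub>2 * b\<^sub>4 * b\<^sub>6)"

definition elliptic_curve_over :: "'a::field set \<Rightarrow> 'a weierstrass \<Rightarrow> bool" where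
  "elliptic_curve_over K E \<longleftrightarrow>
     {a\<^sub>1 E, a\<^sub>2 E, a\<^sub>3 E, a\<^sub>4 E, a\<^sub>6 E} \<subseteq> K \<and> discriminant E \<noteq> 0"

datatype 'a point = Infinity | Affine 'a 'a

fun on_curve :: "'a::field weierstrass \<Rightarrow> 'a point \<Rightarrow> bool" where
  "on_curve E Infinity \<longleftrightarrow> True"
| "on_curve E (Affine x y) \<longleftrightarrow>
     y\<^sup>2 + a\<^sub>1 E * x * y + a\<^sub>3 E * y = x ^ 3 + a\<^sub>2 E * x\<^sup>2 + a\<^sub>4 E * x + a\<^sub>6 E"

text \<open>
  The chord-and-tangent law. The first test says that the two points are opposite, since
  the negative of \<open>(x, y)\<close> is \<open>(x, - y - a\<^sub>1 x - a\<^sub>3)\<close>. Otherwise \<open>l\<close> is the slope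
  of the chord, or of the tangent line if the points coincide.
\<close>

fun point_add :: "'a::field weierstrass \<Rightarrow> 'a point \<Rightarrow> 'a point \<Rightarrow> 'a point" where
  "point_add E Infinity Q = Q"
| "point_add E P Infinity = P"
| "point_add E (Affine x\<^sub>1 y\<^sub>1) (Affine x\<^sub>2 y\<^sub>2) =
     (if x\<^sub>1 = x\<^sub>2 \<and> y\<^sub>1 + y\<^sub>2 + a\<^sub>1 E * x\<^sub>2 + a\<^sub>3 E = 0 then Infinity
      else
        let l = (if x\<^sub>1 = x\<^sub>2
                 then (3 * x\<^sub>1\<^sup>2 + 2 * a\<^sub>2 E * x\<^sub>1 + a\<^sub>4 E - a\<^sub>1 E * y\<^sub>1) / (2 * y\<^sub>1 + a\<^sub>1 E * x\<^sub>1 + a\<^sub>3 E)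
                 else (y\<^sub>2 - y\<^sub>1) / (x\<^sub>2 - x\<^sub>1));
            x\<^sub>3 = l\<^sup>2 + a\<^sub>1 E * l - a\<^sub>2 E - x\<^sub>1 - x\<^sub>2
        in Affine x\<^sub>3 (- (y\<^sub>1 + l * (x\<^sub>3 - x\<^sub>1)) - a\<^sub>1 E * x\<^sub>3 - a\<^sub>3 E))"

definition mordell_weil_group :: "'a::field weierstrass \<Rightarrow> 'a set \<Rightarrow> 'a point monoid" where
  "mordell_weil_group E K =
     \<lparr>carrier = {P. on_curve E P \<and> set_point P \<subseteq> K},
      monoid.mult = point_add E,
      one = Infinity\<rparr>"

definition has_subgroup_isomorphic_to ::
    "('a, 'c) monoid_scheme \<Rightarrow> ('b, 'd) monoid_scheme \<Rightarrow> bool" where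
  "has_subgroup_isomorphic_to M G \<longleftrightarrow> (\<exists>H. subgroup H M \<and> M\<lparr>carrier := H\<rparr> \<cong> G)"

abbreviation free_abelian_group_of_rank :: "nat \<Rightarrow> (nat \<Rightarrow> int) monoid" where
  "free_abelian_group_of_rank r \<equiv> product_group {..<r} (\<lambda>_. integer_group)"

end

theory Submission
  imports Defs "HOL-Number_Theory.Number_Theory"
begin

text \<open>
  Each group is found on an explicit curve \<open>y\<^sup>2 = x\<^sup>3 + a x\<^sup>2 + b x + c\<close> over an explicit quadratic field.
  Orders of torsion points follow from a few doublings. If \<open>g\<^sub>1, \<dots>, g\<^sub>m\<close> in an abelian group \<open>A\<close> are
  independent modulo \<open>2A\<close> and the torsion points among them generate \<open>A[2]\<close>, then the others generate
  a free group that meets the torsion trivially. For a root \<open>e\<close> of the cubic, \<open>x - e\<close> is a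
  homomorphism to the square classes that kills \<open>2A\<close>; composed with quadratic residue symbols at split primes it
  yields characters dual to the chosen points. Where no such character exists, a point is shown not to be in \<open>2A\<close>
  because its halving quartic has no root modulo a split prime.
\<close>

section \<open>The group law\<close>

text \<open>The overview presupposes a group law, and associativity is the obstacle. It comes from
  the parabola y = l x + m + k (x - x1) (x - x2) through P, Q, R: for k nonzero it meets the curve
  in one further point, and both bracketings give the reflection of that point. The parabola does
  not depend on the order of P, Q, R, so symmetry replaces the comparison of large rational
  functions. Only split primes serve as places because their residue field is Z/p: reduction
  replaces the square root \<open>w\<close> of \<open>D\<close> by an integer \<open>s\<close> with
  s^2 = D mod p, and a residue symbol or a search for roots becomes a finite computation with
  integers. The price is that a denominator with respect to the basis 1, \<open>w\<close> is
  controlled only by both primes above p together. The witnesses (points, tangent slopes, primes)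
  are data to be checked: every check is an identity between pairs of rationals or a finite search
  modulo p.\<close>

definition neg_point :: "'a::field point \<Rightarrow> 'a point" where
  "neg_point P = (case P of Infinity \<Rightarrow> Infinity | Affine x y \<Rightarrow> Affine x (- y))"

lemma neg_point_simps [simp]:
  "neg_point Infinity = Infinity" "neg_point (Affine x y) = Affine x (- y)"
  by (simp_all add: neg_point_def)


section \<open>Polynomial identities for lines and parabolas meeting the cubic\<close>

context
  fixes a b c l l' m m' k s t x x' x1 x2 x3 y y1 y2 y3 :: "'a::idom"
begin

text \<open>A common zero of the cubic and its derivative makes the discriminant vanish. The
  left-hand side is four times \<open>discriminant\<close>, by way of 4 b8 = b2 b6 - b4^2.\<close>

lemma alg_nonsingular:
  "x ^ 3 + a * x\<^sup>2 + b * x + c = 0 \<Longrightarrow> 3 * x\<^sup>2 + 2 * a * x + b = 0 \<Longrightarrow>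
    - ((4 * a)\<^sup>2 * (4 * a * (4 * c) - (2 * b)\<^sup>2)) - 4 * (8 * (2 * b) ^ 3) - 4 * (27 * (4 * c)\<^sup>2) + 4 * (9 * (4 * a) * (2 * b) * (4 * c)) = 0"
  by Groebner_Basis.algebra

text \<open>Vieta: the hypotheses compare the coefficients of the cubic minus (l x + m)^2 with those
  of the monic polynomial with roots x1, x2, x3.\<close>

lemma alg_factor:
  "x1 + x2 + x3 = l\<^sup>2 - a \<Longrightarrow> x1 * x2 + x1 * x3 + x2 * x3 = b - 2 * l * m \<Longrightarrow> x1 * x2 * x3 = m\<^sup>2 - c \<Longrightarrow>
    x ^ 3 + a * x\<^sup>2 + b * x + c = (l * x + m)\<^sup>2 + (x - x1) * (x - x2) * (x - x3)"
  by Groebner_Basis.algebra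

lemma alg_deriv:
  "x1 + x2 + x3 = l\<^sup>2 - a \<Longrightarrow> x1 * x2 + x1 * x3 + x2 * x3 = b - 2 * l * m \<Longrightarrow>
    3 * x\<^sup>2 + 2 * a * x + b =
      2 * l * (l * x + m) + (x - x1) * (x - x2) + (x - x1) * (x - x3) + (x - x2) * (x - x3)"
  by Groebner_Basis.algebra

text \<open>The difference of the two hypotheses is divisible by x1 - x2; the factor is kept on both
  sides, to be cancelled once the abscissas are known to differ.\<close>

lemma alg_chord:
  "(l * x1 + m)\<^sup>2 = x1 ^ 3 + a * x1\<^sup>2 + b * x1 + c \<Longrightarrow> (l * x2 + m)\<^sup>2 = x2 ^ 3 + a * x2\<^sup>2 + b * x2 + c \<Longrightarrow>
    (x1 - x2) * (l\<^sup>2 * (x1 + x2) + 2 * l * m) = (x1 - x2) * (x1\<^sup>2 + x1 * x2 + x2\<^sup>2 + a * (x1 + x2) + b)"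
  by Groebner_Basis.algebra

lemma alg_chord2:
  "l\<^sup>2 * (x1 + x2) + 2 * l * m = x1\<^sup>2 + x1 * x2 + x2\<^sup>2 + a * (x1 + x2) + b \<Longrightarrow> x3 = l\<^sup>2 - a - x1 - x2 \<Longrightarrow>
   x1 * x2 + x1 * x3 + x2 * x3 = b - 2 * l * m"
  by Groebner_Basis.algebra

lemma alg_chord3:
  "x1 * x2 + x1 * x3 + x2 * x3 = b - 2 * l * m \<Longrightarrow> x3 = l\<^sup>2 - a - x1 - x2 \<Longrightarrow>
   (l * x1 + m)\<^sup>2 = x1 ^ 3 + a * x1\<^sup>2 + b * x1 + c \<Longrightarrow> x1 * x2 * x3 = m\<^sup>2 - c"
  by Groebner_Basis.algebra

lemma alg_tangent:
  "l * (2 * y1) = 3 * x1\<^sup>2 + 2 * a * x1 + b \<Longrightarrow> y1 = l * x1 + m \<Longrightarrow> x3 = l\<^sup>2 - a - x1 - x1 \<Longrightarrow>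
   x1 * x1 + x1 * x3 + x1 * x3 = b - 2 * l * m"
  by Groebner_Basis.algebra

text \<open>The point (x, y) lies on the parabola with leading coefficient k, and the third
  hypothesis is the equation of the curve after division by (x - x1) (x - x2). It follows that s =
  1/k - l is the slope of the chord from (x3, -(l x3 + m)) to (x, y); everything is multiplied by k
  to stay in an integral domain.\<close>

lemma alg_third:
  "s * k = 1 - k * l \<Longrightarrow> y = l * x + m + k * (x - x1) * (x - x2) \<Longrightarrow>
   k\<^sup>2 * (x - x1) * (x - x2) + 2 * k * (l * x + m) = x - x3 \<Longrightarrow> k * (y + (l * x3 + m)) = k * s * (x - x3)"
  by Groebner_Basis.algebra

lemma alg_third_tangent:
  "s * k = 1 - k * l \<Longrightarrow> k * (x - x1) * (x - x2) + 2 * (l * x + m) = 0 \<Longrightarrow> y = - (l * x + m) \<Longrightarrow>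
   3 * x\<^sup>2 + 2 * a * x + b = 2 * l * (l * x + m) + (x - x1) * (x - x2) \<Longrightarrow>
   k * (3 * x\<^sup>2 + 2 * a * x + b) = k * (s * (2 * y))"
  by Groebner_Basis.algebra

lemma alg_assoc1:
  assumes "y\<^sup>2 = (l * x + m)\<^sup>2 + (x - x1) * (x - x2) * (x - x3)" "y = l * x + m + k * (x - x1) * (x - x2)"
  shows "(x - x1) * (x - x2) * (k\<^sup>2 * (x - x1) * (x - x2) + 2 * k * (l * x + m)) = (x - x1) * (x - x2) * (x - x3)"
proof -
  have "(x - x1) * (x - x2) * (k\<^sup>2 * (x - x1) * (x - x2) + 2 * k * (l * x + m)) = y\<^sup>2 - (l * x + m)\<^sup>2"
    unfolding assms(2) by (simp add: power2_eq_square algebra_simps)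
  with assms(1) show ?thesis by simp
qed

text \<open>On the parabola with leading coefficient k, the chord between abscissas x2 and x3 has
  slope l + k (x3 - x1).\<close>

lemma alg_assoc2:
  assumes "y3 = l * x3 + m + k * (x3 - x1) * (x3 - x2)" "y2 = l * x2 + m" "y2 = l' * x2 + m'" "y3 = l' * x3 + m'"
  shows "(x3 - x2) * l' = (x3 - x2) * (l + k * (x3 - x1))"
proof -
  have "(x3 - x2) * l' = y3 - y2" unfolding assms(3,4) by (simp add: algebra_simps)
  also have "\<dots> = (x3 - x2) * (l + k * (x3 - x1))" unfolding assms(1,2) by (simp add: algebra_simps)
  finally show ?thesis .
qed

lemma alg_assoc3:
  assumes "y1 = l * x1 + m" "y2 = l * x2 + m" "y2 = l' * x2 + m'" "l' = l + k * (x3 - x1)"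
  shows "y1 = l' * x1 + m' + k * (x1 - x2) * (x1 - x3)"
proof -
  have "m' = l * x2 + m - l' * x2" using assms(2,3) by (simp add: algebra_simps)
  then show ?thesis unfolding assms(1,4) by (simp add: algebra_simps)
qed

lemma alg_assoc4:
  assumes "2 * l * y1 = 2 * l' * y1 + (x1 - x3) * (x1 - x)" "l' = l + k * (x3 - x1)"
  shows "(x1 - x3) * (2 * k * y1) = (x1 - x3) * (x1 - x)"
proof -
  have "(x1 - x3) * (2 * k * y1) = 2 * l * y1 - 2 * l' * y1" unfolding assms(2) by (simp add: algebra_simps)
  with assms(1) show ?thesis by simp
qed

text \<open>With t = 1/k, the slopes of the last chord in the two bracketings are t - l and t - l'.
  This identity matches the abscissas of the results, and \<open>alg_assoc6\<close> matches the
  ordinates.\<close>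

lemma alg_assoc5:
  assumes "t * k = 1" "l' = l + k * (x3 - x1)" "x = l\<^sup>2 - a - x1 - x2" "x' = l'\<^sup>2 - a - x2 - x3"
  shows "(t - l)\<^sup>2 - a - x - x3 = (t - l')\<^sup>2 - a - x' - x1"
  using assms by Groebner_Basis.algebra

lemma alg_assoc6:
  assumes "t * k = 1" "l' = l + k * (x3 - x1)" "x = l\<^sup>2 - a - x1 - x2"
    "y3 = l * x3 + m + k * (x3 - x1) * (x3 - x2)" "y1 = l * x1 + m" "x' = (t - l)\<^sup>2 - a - x - x3"
  shows "y3 + (t - l) * (x' - x3) = y1 + (t - l') * (x' - x1)"
proof -
  have "k * (x' - x1 + x3 - x2) = t * k * t - 2 * (t * k) * l"
    unfolding assms(3,6) by (simp add: power2_eq_square algebra_simps)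
  then have "k * (x' - x1 + x3 - x2) = t - 2 * l" using assms(1) by simp
  then have "(x3 - x1) * (k * (x' - x1 + x3 - x2)) = (x3 - x1) * (t - 2 * l)" by simp
  then show ?thesis unfolding assms(2,4,5) by (simp add: algebra_simps)
qed

end

section \<open>The abelian group axioms on y^2 = cubic\<close>

locale cubic_curve =
  fixes a b c :: "'a::field_char_0"
  assumes disc: "discriminant (Weierstrass 0 a 0 b c) \<noteq> 0"
begin

abbreviation "E \<equiv> Weierstrass 0 a 0 b c"

lemma nonsingular:
  assumes "x ^ 3 + a * x\<^sup>2 + b * x + c = 0"
  shows "3 * x\<^sup>2 + 2 * a * x + b \<noteq> 0"
proof
  assume "3 * x\<^sup>2 + 2 * a * x + b = 0"
  from alg_nonsingular[OF assms this] have "4 * discriminant E = 0"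
    by (simp add: discriminant_def Let_def power2_eq_square power3_eq_cube algebra_simps)
  with disc show False by simp
qed

lemma add_chord:
  assumes "x1 \<noteq> x2" "l * (x2 - x1) = y2 - y1" "x3 = l\<^sup>2 - a - x1 - x2"
  shows "point_add E (Affine x1 y1) (Affine x2 y2) = Affine x3 (- (y1 + l * (x3 - x1)))"
proof -
  have "(y2 - y1) / (x2 - x1) = l" using assms by (simp add: field_simps)
  then show ?thesis using assms(1,3) by (simp add: Let_def)
qed

lemma add_tangent:
  assumes "y1 \<noteq> 0" "l * (2 * y1) = 3 * x1\<^sup>2 + 2 * a * x1 + b" "x3 = l\<^sup>2 - a - x1 - x1"
  shows "point_add E (Affine x1 y1) (Affine x1 y1) = Affine x3 (- (y1 + l * (x3 - x1)))"
proof -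
  have "(3 * x1\<^sup>2 + 2 * a * x1 + b) / (2 * y1) = l" using assms by (simp add: field_simps)
  then show ?thesis using assms(1,3) by (simp add: Let_def)
qed

lemma add_opposite: "y1 + y2 = 0 \<Longrightarrow> point_add E (Affine x y1) (Affine x y2) = Infinity"
  by simp

declare point_add.simps(3) [simp del]

text \<open>The line y = l x + m meets the curve at the abscissas x1, x2, x3, counted with
  multiplicity. This treats chords and tangents alike and is symmetric in the three abscissas, which
  the formulas for the sum are not.\<close>

definition lin where
  "lin l m x1 x2 x3 \<longleftrightarrow> x1 + x2 + x3 = l\<^sup>2 - a \<and> x1 * x2 + x1 * x3 + x2 * x3 = b - 2 * l * m \<and>
     x1 * x2 * x3 = m\<^sup>2 - c"

lemma lin_perm: "lin l m x1 x2 x3 \<Longrightarrow> lin l m x1 x3 x2" "lin l m x1 x2 x3 \<Longrightarrow> lin l m x2 x1 x3"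
  by (auto simp: lin_def algebra_simps)

lemma lin_factor:
  assumes "lin l m x1 x2 x3"
  shows "x ^ 3 + a * x\<^sup>2 + b * x + c = (l * x + m)\<^sup>2 + (x - x1) * (x - x2) * (x - x3)"
  using assms alg_factor unfolding lin_def by blast

lemma lin_deriv:
  assumes "lin l m x1 x2 x3"
  shows "3 * x\<^sup>2 + 2 * a * x + b = 2 * l * (l * x + m) + (x - x1) * (x - x2) + (x - x1) * (x - x3) + (x - x2) * (x - x3)"
  using assms alg_deriv unfolding lin_def by blast

lemma add_lin:
  assumes "on_curve E (Affine x1 y1)" "on_curve E (Affine x2 y2)" "\<not> (x1 = x2 \<and> y1 + y2 = 0)"
  obtains l m x3 where "lin l m x1 x2 x3" "y1 = l * x1 + m" "y2 = l * x2 + m"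
    "point_add E (Affine x1 y1) (Affine x2 y2) = Affine x3 (- (l * x3 + m))"
proof (cases "x1 = x2")
  case False
  define l where "l = (y2 - y1) / (x2 - x1)"
  define m where "m = y1 - l * x1"
  define x3 where "x3 = l\<^sup>2 - a - x1 - x2"
  have l: "l * (x2 - x1) = y2 - y1" using False by (simp add: l_def)
  have y: "y1 = l * x1 + m" "y2 = l * x2 + m" using l by (simp_all add: m_def algebra_simps)
  have on: "(l * x1 + m)\<^sup>2 = x1 ^ 3 + a * x1\<^sup>2 + b * x1 + c" "(l * x2 + m)\<^sup>2 = x2 ^ 3 + a * x2\<^sup>2 + b * x2 + c"
    using assms(1,2) y by simp_all
  have "(x1 - x2) * (l\<^sup>2 * (x1 + x2) + 2 * l * m) = (x1 - x2) * (x1\<^sup>2 + x1 * x2 + x2\<^sup>2 + a * (x1 + x2) + b)"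
    using alg_chord[OF on] .
  then have "l\<^sup>2 * (x1 + x2) + 2 * l * m = x1\<^sup>2 + x1 * x2 + x2\<^sup>2 + a * (x1 + x2) + b"
    using False by simp
  then have e2: "x1 * x2 + x1 * x3 + x2 * x3 = b - 2 * l * m"
    using x3_def by (rule alg_chord2)
  have "x1 * x2 * x3 = m\<^sup>2 - c"
    using e2 x3_def on(1) by (rule alg_chord3)
  with e2 have "lin l m x1 x2 x3" by (simp add: lin_def x3_def)
  moreover have "point_add E (Affine x1 y1) (Affine x2 y2) = Affine x3 (- (l * x3 + m))"
    using add_chord[OF False l x3_def] by (simp add: y algebra_simps)
  ultimately show ?thesis using that y by blast
next
  case True
  have "(y1 - y2) * (y1 + y2) = 0" using assms(1,2) True by (simp add: algebra_simps power2_eq_square)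
  then have y12: "y2 = y1" using assms(3) True by simp
  with assms(3) True have y0: "y1 \<noteq> 0" by auto
  define l where "l = (3 * x1\<^sup>2 + 2 * a * x1 + b) / (2 * y1)"
  define m where "m = y1 - l * x1"
  define x3 where "x3 = l\<^sup>2 - a - x1 - x2"
  have l: "l * (2 * y1) = 3 * x1\<^sup>2 + 2 * a * x1 + b" using y0 by (simp add: l_def)
  have y: "y1 = l * x1 + m" by (simp add: m_def)
  have on: "y1\<^sup>2 = x1 ^ 3 + a * x1\<^sup>2 + b * x1 + c" using assms(1) by simp
  have e2: "x1 * x2 + x1 * x3 + x2 * x3 = b - 2 * l * m"
    using alg_tangent[OF l y] True x3_def by simp
  have "x1 * x2 * x3 = m\<^sup>2 - c"
    using e2 x3_def on[unfolded y] by (rule alg_chord3)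
  with e2 have "lin l m x1 x2 x3" by (simp add: lin_def x3_def)
  moreover have "point_add E (Affine x1 y1) (Affine x2 y2) = Affine x3 (- (l * x3 + m))"
    using add_tangent[OF y0 l, of x3] True y12 by (simp add: x3_def m_def algebra_simps)
  ultimately show ?thesis using that y y12 True by metis
qed

lemma lin_add:
  assumes "lin l m x1 x2 x3"
  shows "point_add E (Affine x1 (l * x1 + m)) (Affine x2 (l * x2 + m)) = Affine x3 (- (l * x3 + m))"
proof (cases "x1 = x2")
  case False
  have "x3 = l\<^sup>2 - a - x1 - x2" using assms by (simp add: lin_def algebra_simps)
  then show ?thesis using add_chord[OF False, of l "l * x2 + m" "l * x1 + m" x3] by (simp add: algebra_simps)
next
  case True
  have f: "x1 ^ 3 + a * x1\<^sup>2 + b * x1 + c = (l * x1 + m)\<^sup>2"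
    using lin_factor[OF assms, of x1] by simp
  have d: "3 * x1\<^sup>2 + 2 * a * x1 + b = 2 * l * (l * x1 + m)"
    using lin_deriv[OF assms, of x1] True by simp
  \<comment> \<open>If this ordinate vanished, \<open>f\<close> and \<open>d\<close> would make the
    cubic and its derivative vanish together at x1.\<close>
  have y0: "l * x1 + m \<noteq> 0" using nonsingular[of x1] f d by auto
  have "x3 = l\<^sup>2 - a - x1 - x2" using assms by (simp add: lin_def algebra_simps)
  then show ?thesis using add_tangent[OF y0, of l x1 x3] d True by (simp add: algebra_simps)
qed

text \<open>This adds R = (x, y) to the sum of the points at x1 and x2 in terms of the leading
  coefficient k of the parabola through all three. The slope 1/k - l stays valid when the last chord
  degenerates to a tangent, so no case on x3 = x survives in the conclusion.\<close>

lemma add_third: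
  assumes L: "lin l m x1 x2 x3" and on: "on_curve E (Affine x y)"
    and k1: "y = l * x + m + k * (x - x1) * (x - x2)"
    and k2: "k\<^sup>2 * (x - x1) * (x - x2) + 2 * k * (l * x + m) = x - x3"
  shows "point_add E (Affine x3 (- (l * x3 + m))) (Affine x y) =
    (if k = 0 then Infinity else
      let s = 1 / k - l; xs = s\<^sup>2 - a - x3 - x in Affine xs (- (y + s * (xs - x))))"
proof (cases "k = 0")
  \<comment> \<open>For k = 0 the parabola is the line itself, R is its third intersection with the
    curve, and the sum is the point at infinity.\<close>
  case True
  then have "x3 = x" using k2 by simp
  then show ?thesis using True k1 by (simp add: add_opposite)
next
  case k: False
  define s where "s = 1 / k - l"
  have sk: "s * k = 1 - k * l" using k by (simp add: s_def field_simps)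
  show ?thesis
  proof (cases "x3 = x")
    case False
    have "k * (y + (l * x3 + m)) = k * s * (x - x3)"
      using alg_third[OF sk k1 k2] .
    then have e: "s * (x - x3) = y - - (l * x3 + m)" using k by (simp add: mult.assoc) (simp add: algebra_simps)
    have e': "- (l * x3 + m) + s * (z - x3) = y + s * (z - x)" for z
    proof -
      have "s * (z - x3) = s * (z - x) + s * (x - x3)" by (simp add: algebra_simps)
      then show ?thesis using e by (simp only:) simp
    qed
    show ?thesis
      unfolding add_chord[OF False e refl] Let_def s_def[symmetric] e' using k
      by (simp only: if_False)
  next
    case True
    have "k * (k * (x - x1) * (x - x2) + 2 * (l * x + m)) = 0" using k2 True by (simp add: algebra_simps power2_eq_square)
    then have e: "k * (x - x1) * (x - x2) + 2 * (l * x + m) = 0" using k by simp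
    have "y + (l * x + m) = k * (x - x1) * (x - x2) + 2 * (l * x + m)"
      unfolding k1 by (simp add: algebra_simps)
    with e have y: "y = - (l * x + m)" by (simp only: eq_neg_iff_add_eq_0)
    have d: "3 * x\<^sup>2 + 2 * a * x + b = 2 * l * (l * x + m) + (x - x1) * (x - x2)"
      using lin_deriv[OF L, of x] True by simp
    have y0: "y \<noteq> 0"
    proof
      assume "y = 0"
      then have "- (l * x + m) = 0" using y by metis
      then have "l * x + m = 0" by (simp only: neg_equal_0_iff_equal)
      moreover from this e k have "(x - x1) * (x - x2) = 0" by simp
      ultimately show False using nonsingular[of x] on d \<open>y = 0\<close> by simp
    qed
    have "k * (3 * x\<^sup>2 + 2 * a * x + b) = k * (s * (2 * y))"
      using alg_third_tangent[OF sk e y d] .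
    then have e: "s * (2 * y) = 3 * x\<^sup>2 + 2 * a * x + b" using k by simp
    show ?thesis using add_tangent[OF y0 e refl] True k y by (simp add: Let_def flip: s_def)
  qed
qed

lemma add_commute:
  assumes "on_curve E P" "on_curve E Q"
  shows "point_add E P Q = point_add E Q P"
proof (cases P; cases Q)
  fix x1 y1 x2 y2 assume PQ: "P = Affine x1 y1" "Q = Affine x2 y2"
  show ?thesis
  proof (cases "x1 = x2 \<and> y1 + y2 = 0")
    case True
    then show ?thesis using PQ by (simp add: add_opposite add.commute)
  next
    case False
    then obtain l m x3 where "lin l m x1 x2 x3" "y1 = l * x1 + m" "y2 = l * x2 + m"
      "point_add E (Affine x1 y1) (Affine x2 y2) = Affine x3 (- (l * x3 + m))"
      using add_lin assms PQ by blast
    then show ?thesis using lin_add[OF lin_perm(2)] PQ by metis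
  qed
qed simp_all

lemma on_curve_add:
  assumes "on_curve E P" "on_curve E Q"
  shows "on_curve E (point_add E P Q)"
proof (cases P; cases Q)
  fix x1 y1 x2 y2 assume PQ: "P = Affine x1 y1" "Q = Affine x2 y2"
  show ?thesis
  proof (cases "x1 = x2 \<and> y1 + y2 = 0")
    case True
    then show ?thesis using PQ by (simp add: add_opposite)
  next
    case False
    then obtain l m x3 where L: "lin l m x1 x2 x3"
      "point_add E (Affine x1 y1) (Affine x2 y2) = Affine x3 (- (l * x3 + m))"
      using add_lin assms PQ by blast
    show ?thesis unfolding PQ L(2) using lin_factor[OF L(1), of x3] by (simp add: power2_eq_square algebra_simps)
  qed
qed (use assms in simp_all)

lemma on_curve_neg: "on_curve E P \<Longrightarrow> on_curve E (neg_point P)"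
  by (cases P) simp_all

lemma add_neg: "point_add E P (neg_point P) = Infinity"
  by (cases P) (simp_all add: add_opposite)

lemma neg_neg [simp]: "neg_point (neg_point P) = P"
  by (cases P) simp_all

text \<open>The reflected line y = - l x - m passes through -P, P + Q and -Q, so the chord through
  the first two yields Q.\<close>

lemma neg_add_cancel:
  assumes "on_curve E P" "on_curve E Q"
  shows "point_add E (neg_point P) (point_add E P Q) = Q"
proof (cases P; cases Q)
  fix x1 y1 x2 y2 assume PQ: "P = Affine x1 y1" "Q = Affine x2 y2"
  show ?thesis
  proof (cases "x1 = x2 \<and> y1 + y2 = 0")
    case True
    then have "y2 = - y1" by (simp add: eq_neg_iff_add_eq_0 add.commute)
    then show ?thesis using PQ True by (simp add: add_opposite)
  next
    case False
    then obtain l m x3 where L: "lin l m x1 x2 x3" "y1 = l * x1 + m" "y2 = l * x2 + m"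
      "point_add E (Affine x1 y1) (Affine x2 y2) = Affine x3 (- (l * x3 + m))"
      using add_lin assms PQ by blast
    have "lin (- l) (- m) x1 x3 x2" using lin_perm(1)[OF L(1)] by (simp add: lin_def)
    from lin_add[OF this] show ?thesis using L PQ by simp
  qed
next
  fix x y assume PQ: "P = Affine x y" "Q = Infinity"
  then show ?thesis by (simp add: add_opposite)
qed simp_all

text \<open>Both (P + Q) + R and (Q + R) + P are evaluated by \<open>add_third\<close>, with the
  same k: it is the leading coefficient of the parabola through P, Q, R, which is tangent to the
  curve at P if P = Q. The roles of the lines PQ and QR are exchanged by l' = l + k (x3 -
  x1).\<close>

lemma add_assoc_generic:
  assumes P: "on_curve E (Affine x1 y1)" and Q: "on_curve E (Affine x2 y2)" and R: "on_curve E (Affine x3 y3)"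
    and "\<not> (x1 = x2 \<and> y1 + y2 = 0)" "x1 \<noteq> x3" "x2 \<noteq> x3"
  shows "point_add E (point_add E (Affine x1 y1) (Affine x2 y2)) (Affine x3 y3) =
    point_add E (Affine x1 y1) (point_add E (Affine x2 y2) (Affine x3 y3))"
proof -
  obtain l m xA where L: "lin l m x1 x2 xA" "y1 = l * x1 + m" "y2 = l * x2 + m"
      "point_add E (Affine x1 y1) (Affine x2 y2) = Affine xA (- (l * xA + m))"
    using add_lin[OF P Q] assms(4) by blast
  obtain l' m' xB where L': "lin l' m' x2 x3 xB" "y2 = l' * x2 + m'" "y3 = l' * x3 + m'"
      "point_add E (Affine x2 y2) (Affine x3 y3) = Affine xB (- (l' * xB + m'))"
    using add_lin[OF Q R] assms(6) by blast
  define D where "D = (x3 - x1) * (x3 - x2)"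
  have D: "D \<noteq> 0" using assms(5,6) by (simp add: D_def)
  define k where "k = (y3 - (l * x3 + m)) / D"
  have y3: "y3 = l * x3 + m + k * (x3 - x1) * (x3 - x2)"
    using D by (simp add: k_def mult.assoc flip: D_def)
  have "y3\<^sup>2 = (l * x3 + m)\<^sup>2 + (x3 - x1) * (x3 - x2) * (x3 - xA)"
    using R lin_factor[OF L(1), of x3] by simp
  then have "D * (k\<^sup>2 * (x3 - x1) * (x3 - x2) + 2 * k * (l * x3 + m)) = D * (x3 - xA)"
    unfolding D_def using y3 by (intro alg_assoc1)
  then have k2: "k\<^sup>2 * (x3 - x1) * (x3 - x2) + 2 * k * (l * x3 + m) = x3 - xA"
    using D by simp
  have "(x3 - x2) * l' = (x3 - x2) * (l + k * (x3 - x1))"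
    using y3 L(3) L'(2,3) by (intro alg_assoc2)
  then have l': "l' = l + k * (x3 - x1)" using assms(6) by simp
  have y1: "y1 = l' * x1 + m' + k * (x1 - x2) * (x1 - x3)"
    using L(2,3) L'(2) l' by (intro alg_assoc3)
  have k2': "k\<^sup>2 * (x1 - x2) * (x1 - x3) + 2 * k * (l' * x1 + m') = x1 - xB"
  proof (cases "x1 = x2")
    case False
    have "y1\<^sup>2 = (l' * x1 + m')\<^sup>2 + (x1 - x2) * (x1 - x3) * (x1 - xB)"
      using P lin_factor[OF L'(1), of x1] by simp
    then have "(x1 - x2) * (x1 - x3) * (k\<^sup>2 * (x1 - x2) * (x1 - x3) + 2 * k * (l' * x1 + m')) =
        (x1 - x2) * (x1 - x3) * (x1 - xB)"
      using y1 by (intro alg_assoc1)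
    then show ?thesis using False assms(5) by simp
  next
    case True
    \<comment> \<open>Here P = Q, so the factor x1 - x2 cannot be cancelled from the equation of the
      curve. The derivative of the cubic at x1, expanded along both lines, supplies the missing
      equation.\<close>
    have "2 * l * y1 = 2 * l' * y1 + (x1 - x3) * (x1 - xB)"
      using lin_deriv[OF L(1), of x1] lin_deriv[OF L'(1), of x1] True L(2) L'(2) y1 by simp
    then have "(x1 - x3) * (2 * k * y1) = (x1 - x3) * (x1 - xB)"
      using l' by (intro alg_assoc4)
    then show ?thesis using assms(5) True y1 by simp
  qed
  have xA: "xA = l\<^sup>2 - a - x1 - x2" and xB: "xB = l'\<^sup>2 - a - x2 - x3"
    using L(1) L'(1) by (auto simp: lin_def algebra_simps)
  have "point_add E (Affine xA (- (l * xA + m))) (Affine x3 y3) =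
      point_add E (Affine xB (- (l' * xB + m'))) (Affine x1 y1)"
  proof (cases "k = 0")
    case True
    then show ?thesis unfolding add_third[OF L(1) R y3 k2] add_third[OF L'(1) P y1 k2'] by simp
  next
    case False
    define t where "t = 1 / k"
    have t: "t * k = 1" using False by (simp add: t_def)
    define xs where "xs = (t - l)\<^sup>2 - a - xA - x3"
    have xs': "(t - l')\<^sup>2 - a - xB - x1 = xs"
      unfolding xs_def using alg_assoc5[OF t l' xA xB] by simp
    have "y3 + (t - l) * (xs - x3) = y1 + (t - l') * (xs - x1)"
      using t l' xA y3 L(2) xs_def by (rule alg_assoc6)
    then show ?thesis
      unfolding add_third[OF L(1) R y3 k2] add_third[OF L'(1) P y1 k2'] Let_def t_def[symmetric] xs'
        xs_def[symmetric]
      using False by (simp only: if_False)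
  qed
  then show ?thesis
    using L(4) L'(4) add_commute[OF P on_curve_add[OF Q R]] by simp
qed

theorem point_add_assoc:
  assumes P: "on_curve E P" and Q: "on_curve E Q" and R: "on_curve E R"
  shows "point_add E (point_add E P Q) R = point_add E P (point_add E Q R)"
proof (cases "P = Infinity \<or> Q = Infinity \<or> R = Infinity")
  case True
  have inf: "point_add E U Infinity = U" for U by (cases U) simp_all
  from True show ?thesis by (auto simp: inf)
next
  case False
  then obtain x1 y1 x2 y2 x3 y3 where PQR: "P = Affine x1 y1" "Q = Affine x2 y2" "R = Affine x3 y3"
    by (metis point.exhaust)
  have eqx: "y = y' \<or> y + y' = 0" if "on_curve E (Affine x y)" "on_curve E (Affine x y')" for x y y'
  proof -
    have "(y - y') * (y + y') = 0" using that by (simp add: algebra_simps power2_eq_square)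
    then show ?thesis by simp
  qed
  have opp: "point_add E (point_add E U V) W = point_add E U (point_add E V W)"
    if "U = neg_point V" "on_curve E U" "on_curve E V" "on_curve E W" for U V W
    using that neg_add_cancel[of V W] add_neg[of V] add_commute[of U V] by simp
  have inf: "point_add E U Infinity = U" for U by (cases U) simp_all
  consider (a12) "P = neg_point Q" | (a23) "R = neg_point Q" | (a13) "R = neg_point P"
    | (gen) "P \<noteq> neg_point Q" "R \<noteq> neg_point Q" "R \<noteq> neg_point P" by blast
  then show ?thesis
  proof cases
    case a12
    then show ?thesis using opp assms by blast
  next
    case a23
    have "point_add E (point_add E P Q) R = point_add E R (point_add E Q P)"
      using add_commute[OF P Q] add_commute[OF on_curve_add[OF Q P] R] by simp
    also have "\<dots> = P" using neg_add_cancel[OF Q P] a23 by simp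
    finally show ?thesis using add_neg[of Q] a23 inf by simp
  next
    case a13
    have "point_add E (point_add E P Q) R = point_add E R (point_add E P Q)"
      using add_commute[OF on_curve_add[OF P Q] R] .
    also have "\<dots> = Q" using neg_add_cancel[OF P Q] a13 by simp
    also have "\<dots> = point_add E P (point_add E R Q)"
      using neg_add_cancel[OF R Q] a13 by simp
    also have "\<dots> = point_add E P (point_add E Q R)" using add_commute[OF Q R] by simp
    finally show ?thesis .
  next
    case gen
    have n12: "\<not> (x1 = x2 \<and> y1 + y2 = 0)" using gen(1) PQR by (auto simp: eq_neg_iff_add_eq_0)
    have n23: "\<not> (x2 = x3 \<and> y2 + y3 = 0)" using gen(2) PQR by (auto simp: eq_neg_iff_add_eq_0 add.commute)
    have n13: "\<not> (x1 = x3 \<and> y1 + y3 = 0)" using gen(3) PQR by (auto simp: eq_neg_iff_add_eq_0 add.commute)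
    \<comment> \<open>With opposite pairs excluded, equal abscissas mean equal points. The case P =
      R is commutativity, and Q = R is the generic case for R, R, P.\<close>
    have "P = R" if "x1 = x3" using eqx[of x1 y1 y3] n13 P R PQR that by auto
    moreover have "Q = R" if "x2 = x3" using eqx[of x2 y2 y3] n23 Q R PQR that by auto
    moreover have ?thesis if "P = R"
      using add_commute[OF on_curve_add[OF P Q] R] add_commute[OF P Q] that by simp
    moreover have ?thesis if "Q = R" "x1 \<noteq> x3"
    proof -
      have "point_add E (point_add E R R) P = point_add E R (point_add E R P)"
        using add_assoc_generic[of x3 y3 x3 y3 x1 y1] n23 PQR R P that by auto
      then show ?thesis
        using add_commute[OF on_curve_add[OF P R] R] add_commute[OF P R] add_commute[OF on_curve_add[OF R R] P] that(1)
        by simp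
    qed
    moreover have ?thesis if "x1 \<noteq> x3" "x2 \<noteq> x3"
      using add_assoc_generic[OF P[unfolded PQR] Q[unfolded PQR] R[unfolded PQR] n12 that]
      by (simp only: PQR)
    ultimately show ?thesis by blast
  qed
qed

end

section \<open>Subgroups of abelian groups detected modulo squares\<close>

lemma (in comm_group) hom_DirProd_mult:
  assumes f: "f \<in> hom T G" and g: "g \<in> hom R G"
  shows "(\<lambda>(x, y). f x \<otimes> g y) \<in> hom (T \<times>\<times> R) G"
proof -
  have car: "f x \<in> carrier G" "g y \<in> carrier G" if "x \<in> carrier T" "y \<in> carrier R" for x y
    using f g that by (auto simp: hom_def)
  show ?thesis using f g by (auto simp: hom_def car m_ac Pi_iff)
qed

lemma (in comm_group) has_subgroup_isomorphic_to_DirProd: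
  assumes T: "group T" and R: "group R" and f: "f \<in> hom T G" and g: "g \<in> hom R G"
    and inj: "\<And>x y. x \<in> carrier T \<Longrightarrow> y \<in> carrier R \<Longrightarrow> f x \<otimes> g y = \<one> \<Longrightarrow> x = \<one>\<^bsub>T\<^esub> \<and> y = \<one>\<^bsub>R\<^esub>"
  shows "has_subgroup_isomorphic_to G (T \<times>\<times> R)"
proof -
  let ?h = "\<lambda>(x, y). f x \<otimes> g y"
  have TR: "group (T \<times>\<times> R)" using T R by (rule DirProd_group)
  have hom: "?h \<in> hom (T \<times>\<times> R) G" using f g by (rule hom_DirProd_mult)
  interpret h: group_hom "T \<times>\<times> R" G ?h
    using TR hom is_group by (simp add: group_hom_def group_hom_axioms_def)
  have "kernel (T \<times>\<times> R) G ?h = {\<one>\<^bsub>T \<times>\<times> R\<^esub>}"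
  proof
    show "kernel (T \<times>\<times> R) G ?h \<subseteq> {\<one>\<^bsub>T \<times>\<times> R\<^esub>}" using inj by (auto simp: kernel_def)
    show "{\<one>\<^bsub>T \<times>\<times> R\<^esub>} \<subseteq> kernel (T \<times>\<times> R) G ?h"
      using h.hom_one monoid.one_closed[OF group.is_monoid[OF TR]] by (simp add: kernel_def)
  qed
  then have "inj_on ?h (carrier (T \<times>\<times> R))" using h.inj_iff_trivial_ker by blast
  then have "?h \<in> iso (T \<times>\<times> R) (G\<lparr>carrier := ?h ` carrier (T \<times>\<times> R)\<rparr>)"
    using hom by (auto simp: iso_def hom_def bij_betw_def)
  then have "T \<times>\<times> R \<cong> G\<lparr>carrier := ?h ` carrier (T \<times>\<times> R)\<rparr>" by (auto simp: is_iso_def)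
  then have "G\<lparr>carrier := ?h ` carrier (T \<times>\<times> R)\<rparr> \<cong> T \<times>\<times> R" by (rule group.iso_sym[OF TR])
  then show ?thesis
    unfolding has_subgroup_isomorphic_to_def using h.img_is_subgroup by blast
qed

text \<open>In multiplicative notation this is the subgroup 2A of an abelian group A.\<close>

definition (in monoid) squares :: "'a set" where
  "squares = {x \<otimes> x |x. x \<in> carrier G}"

definition (in comm_group) combination :: "nat \<Rightarrow> (nat \<Rightarrow> 'a) \<Rightarrow> (nat \<Rightarrow> int) \<Rightarrow> 'a" where
  "combination m g n = (\<Otimes>i\<in>{..<m}. g i [^] n i)"

context comm_group begin

lemma combination_closed:
  assumes "\<And>i. i < m \<Longrightarrow> g i \<in> carrier G"
  shows "combination m g n \<in> carrier G"
  unfolding combination_def using assms by (intro finprod_closed) auto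

lemma combination_add:
  assumes "\<And>i. i < m \<Longrightarrow> g i \<in> carrier G"
  shows "combination m g (\<lambda>i. n i + k i) = combination m g n \<otimes> combination m g k"
proof -
  have "combination m g (\<lambda>i. n i + k i) = (\<Otimes>i\<in>{..<m}. g i [^] n i \<otimes> g i [^] k i)"
    unfolding combination_def using assms by (intro finprod_cong') (auto simp: int_pow_mult)
  also have "\<dots> = combination m g n \<otimes> combination m g k"
    unfolding combination_def using assms by (intro finprod_multf) auto
  finally show ?thesis .
qed

lemma combination_Suc:
  assumes "\<And>i. i \<le> m \<Longrightarrow> g i \<in> carrier G"
  shows "combination (Suc m) g n = combination m g n \<otimes> g m [^] n m"
proof -
  have "combination (Suc m) g n = g m [^] n m \<otimes> combination m g n"
    unfolding combination_def lessThan_Suc using assms by (subst finprod_insert) auto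
  also have "\<dots> = combination m g n \<otimes> g m [^] n m"
    using assms by (intro m_comm combination_closed) auto
  finally show ?thesis .
qed

lemma combination_0: "combination 0 g n = \<one>"
  by (simp add: combination_def)

lemma combination_cong:
  assumes "\<And>i. i < m \<Longrightarrow> g i \<in> carrier G" "\<And>i. i < m \<Longrightarrow> n i = k i"
  shows "combination m g n = combination m g k"
  unfolding combination_def using assms by (intro finprod_cong') auto

lemma combination_shift:
  assumes "\<And>i. i \<le> m \<Longrightarrow> g i \<in> carrier G"
  shows "combination (Suc m) g n = g 0 [^] n 0 \<otimes> combination m (\<lambda>i. g (Suc i)) (\<lambda>i. n (Suc i))"
  using assms
proof (induction m)
  case 0
  then show ?case using combination_Suc[of 0 g n] by (simp add: combination_0)
next
  case (Suc m)
  have "combination (Suc (Suc m)) g n =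
      g 0 [^] n 0 \<otimes> combination m (\<lambda>i. g (Suc i)) (\<lambda>i. n (Suc i)) \<otimes> g (Suc m) [^] n (Suc m)"
    using Suc by (subst combination_Suc) auto
  also have "\<dots> = g 0 [^] n 0 \<otimes> combination (Suc m) (\<lambda>i. g (Suc i)) (\<lambda>i. n (Suc i))"
    using Suc.prems by (subst combination_Suc) (auto simp: m_assoc combination_closed)
  finally show ?case .
qed

lemma combination_in_subgroup:
  assumes "subgroup N G" "\<And>i. i < m \<Longrightarrow> g i \<in> N \<or> n i = 0" "\<And>i. i < m \<Longrightarrow> g i \<in> carrier G"
  shows "combination m g n \<in> N"
  using assms(2,3)
proof (induction m)
  case 0
  then show ?case using assms(1) by (simp add: combination_0 subgroup.one_closed)
next
  case (Suc m)
  have "g m [^] n m \<in> N"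
    using Suc.prems[of m] subgroup_int_pow_closed[OF assms(1)] subgroup.one_closed[OF assms(1)] by force
  then show ?case using Suc by (subst combination_Suc) (auto intro!: subgroup.m_closed[OF assms(1)])
qed

text \<open>\<open>N\<close> acts as the kernel of a character that is nontrivial on
  \<open>g i\<close> alone among the generators. If \<open>n i\<close> were odd, the combination
  would be \<open>g i\<close> times an even power of \<open>g i\<close> times other generators; all
  but the first factor lie in \<open>N\<close>, and so would \<open>g i\<close>.\<close>

lemma even_if_square:
  fixes n :: "nat \<Rightarrow> int"
  assumes g: "\<And>i. i < m \<Longrightarrow> g i \<in> carrier G"
    and N: "subgroup N G" "squares \<subseteq> N" "\<And>j. j < m \<Longrightarrow> g j \<in> N \<longleftrightarrow> j \<noteq> i"
    and sq: "combination m g n \<in> squares" and i: "i < m"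
  shows "even (n i)"
proof (rule ccontr)
  assume odd: "odd (n i)"
  define k where "k j = (if j = i then n i - 1 else 0)" for j
  define k' where "k' j = (if j = i then 0 else n j)" for j
  define k'' where "k'' j = (if j = i then 1 else 0 :: int)" for j :: nat
  have "combination m g n = combination m g (\<lambda>j. k'' j + (k' j + (k j + 0)))"
    using g by (intro combination_cong) (auto simp: k_def k'_def k''_def)
  also have "\<dots> = combination m g k'' \<otimes> (combination m g k' \<otimes> combination m g k)"
    using g by (simp add: combination_add)
  finally have n: "combination m g n = combination m g k'' \<otimes> (combination m g k' \<otimes> combination m g k)" .
  have "combination m g k' \<in> N" using g N by (intro combination_in_subgroup) (auto simp: k'_def)
  moreover have "combination m g k \<in> N"
  proof -
    have "combination m g k = combination m g (\<lambda>j. k j div 2 + k j div 2)"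
      using g odd by (intro combination_cong) (auto simp: k_def elim: oddE)
    also have "\<dots> = combination m g (\<lambda>j. k j div 2) \<otimes> combination m g (\<lambda>j. k j div 2)"
      using g by (rule combination_add)
    also have "\<dots> \<in> N" using N(2) combination_closed[of m g, OF g] unfolding squares_def by blast
    finally show ?thesis .
  qed
  ultimately have "combination m g k' \<otimes> combination m g k \<in> N" using N(1) by (simp add: subgroup.m_closed)
  moreover have "combination m g n \<in> N" using sq N(2) by blast
  ultimately have "combination m g k'' \<in> N"
    using N(1) combination_closed[OF g]
    by (subst inv_solve_right[OF _ _ _ , THEN iffD2, OF _ _ _ n]) (auto simp: subgroup.m_closed subgroup.m_inv_closed)
  moreover have "combination m g k'' = g i"
  proof -
    have "combination m g k'' = (\<Otimes>j\<in>{..<m}. if i = j then g j else \<one>)"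
      unfolding combination_def using g by (intro finprod_cong') (auto simp: k''_def)
    also have "\<dots> = g i" using i g by (intro finprod_singleton) auto
    finally show ?thesis .
  qed
  ultimately show False using N(3)[OF i] by simp
qed

text \<open>Infinite descent. A relation has even exponents by \<open>ev\<close>; half of it is a
  2-torsion element, hence a combination \<open>c\<close> supported below \<open>r\<close>.
  Subtracting \<open>c\<close> gives a new relation whose exponents from \<open>r\<close> on are
  exactly the halves of the old ones. Repetition shows that every power of 2 divides them.\<close>

lemma relation_trivial:
  fixes n :: "nat \<Rightarrow> int"
  assumes g: "\<And>i. i < m \<Longrightarrow> g i \<in> carrier G"
    and ev: "\<And>n i. combination m g n \<in> squares \<Longrightarrow> i < m \<Longrightarrow> even (n i)"
    and tor: "\<And>x. x \<in> carrier G \<Longrightarrow> x \<otimes> x = \<one> \<Longrightarrow> \<exists>c. x = combination m g c \<and> (\<forall>i\<ge>r. c i = 0)"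
    and rel: "combination m g n = \<one>" and i: "r \<le> i" "i < m"
  shows "n i = 0"
proof -
  have "2 ^ N dvd n i" for N
    using rel
  proof (induction N arbitrary: n)
    case (Suc N)
    have one: "\<one> \<in> squares" by (force simp: squares_def)
    define k where "k j = n j div 2" for j
    have n: "n j = k j + k j" if "j < m" for j
      using ev[of n j] Suc.prems one that by (auto simp: k_def)
    have "combination m g k \<otimes> combination m g k = combination m g n"
      using g n by (subst combination_add[symmetric]) (auto intro!: combination_cong)
    with Suc.prems tor[of "combination m g k"] obtain c where
      c: "combination m g k = combination m g c" "\<forall>i\<ge>r. c i = 0"
      using combination_closed[OF g] by auto
    have "combination m g (\<lambda>j. (k j - c j) + c j) = combination m g (\<lambda>j. k j - c j) \<otimes> combination m g c"
      using g by (rule combination_add)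
    then have "combination m g (\<lambda>j. k j - c j) \<otimes> combination m g c = combination m g c" using c by simp
    then have "combination m g (\<lambda>j. k j - c j) = \<one>"
      using combination_closed[OF g] by (simp add: r_cancel_one')
    from Suc.IH[OF this] have "2 ^ N dvd k i" using c i by simp
    then show ?case using n[OF i(2)] by (auto simp: dvd_def)
  qed simp
  \<comment> \<open>The power 2^|n i| already exceeds |n i|, so divisibility by it forces
    zero.\<close>
  then have "2 ^ nat \<bar>n i\<bar> dvd n i" .
  moreover have "\<bar>n i\<bar> < 2 ^ nat \<bar>n i\<bar>"
    using of_nat_less_iff[where 'a = int, THEN iffD2, OF less_exp[of "nat \<bar>n i\<bar>"]] by simp
  ultimately show "n i = 0" using zdvd_not_zless[of "\<bar>n i\<bar>" "2 ^ nat \<bar>n i\<bar>"] by (cases "n i = 0") auto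
qed

section \<open>Embedding products of cyclic and free groups\<close>

lemma hom_integer_mod_group:
  assumes t: "t \<in> carrier G" "t [^] k = \<one>" and k: "k > 0"
  shows "(\<lambda>x::int. t [^] x) \<in> hom (integer_mod_group k) G"
proof (rule homI)
  fix x y :: int
  have "t [^] ((x + y) mod int k) = t [^] ((x + y) mod int k) \<otimes> (t [^] k) [^] ((x + y) div int k)"
    using t by simp
  also have "\<dots> = t [^] (x + y)"
    using t(1) by (simp add: int_pow_int[symmetric] int_pow_pow int_pow_mult[symmetric] del: int_pow_int)
  finally show "t [^] (x \<otimes>\<^bsub>integer_mod_group k\<^esub> y) = t [^] x \<otimes> t [^] y"
    using k t by (simp add: integer_mod_group_def int_pow_mult)
qed (use t in auto)

lemma hom_product_group:
  assumes "\<And>i. i < m \<Longrightarrow> g i \<in> carrier G"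
  shows "combination m g \<in> hom (free_abelian_group_of_rank m) G"
proof (rule homI)
  fix x y :: "nat \<Rightarrow> int"
  have "combination m g (x \<otimes>\<^bsub>free_abelian_group_of_rank m\<^esub> y) = combination m g (\<lambda>i. x i + y i)"
    using assms by (intro combination_cong) (auto simp: product_group_def)
  then show "combination m g (x \<otimes>\<^bsub>free_abelian_group_of_rank m\<^esub> y) = combination m g x \<otimes> combination m g y"
    using combination_add[OF assms] by simp
qed (use assms in \<open>auto intro: combination_closed\<close>)

lemma zero_if_one_integer_mod_group:
  assumes "x \<in> carrier (integer_mod_group k)" "int k dvd x" "k > 0"
  shows "x = 0"
proof (rule ccontr)
  assume "x \<noteq> 0"
  with assms have "int k \<le> x" by (intro zdvd_imp_le) (auto simp: carrier_integer_mod_group)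
  with assms show False by (simp add: carrier_integer_mod_group)
qed

text \<open>Without 2-torsion the descent can be run on \<open>p\<close> alone, and independence
  modulo squares only says that \<open>p\<close> is not a square. The torsion point \<open>t\<close>
  is separated afterwards by taking a k-th power.\<close>

lemma has_subgroup_cyclic_times_Z:
  assumes t: "t \<in> carrier G" "t [^] k = \<one>" "\<And>x::int. t [^] x = \<one> \<Longrightarrow> int k dvd x" and k: "k > 0"
    and p: "p \<in> carrier G" "p \<notin> squares" and tor: "\<And>x. x \<in> carrier G \<Longrightarrow> x \<otimes> x = \<one> \<Longrightarrow> x = \<one>"
  shows "has_subgroup_isomorphic_to G (integer_mod_group k \<times>\<times> integer_group)"
proof (rule has_subgroup_isomorphic_to_DirProd)
  have comb: "combination (Suc 0) (\<lambda>_. p) n = p [^] n 0" for n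
    using combination_Suc[of 0 "\<lambda>_. p" n] p by (simp add: combination_0)
  have free: "y = 0" if "p [^] y = \<one>" for y :: int
  proof -
    have "(\<lambda>_::nat. y) 0 = 0"
    proof (rule relation_trivial[where m = "Suc 0" and g = "\<lambda>_. p" and r = 0])
      fix n :: "nat \<Rightarrow> int" and i :: nat
      assume sq: "combination (Suc 0) (\<lambda>_. p) n \<in> squares" and "i < Suc 0"
      then obtain q where q: "q \<in> carrier G" "p [^] n 0 = q \<otimes> q" by (auto simp: comb squares_def)
      show "even (n i)"
      proof (rule ccontr)
        assume "odd (n i)"
        then obtain j where j: "n 0 = 2 * j + 1" using \<open>i < Suc 0\<close> by (auto elim: oddE)
        define z where "z = p [^] (- j) \<otimes> q"
        have z: "z \<in> carrier G" using p q by (simp add: z_def)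
        have "z \<otimes> z = p [^] (- j) \<otimes> p [^] (- j) \<otimes> (q \<otimes> q)"
          unfolding z_def using p q by (simp add: m_ac)
        also have "\<dots> = p [^] (- j + - j + (2 * j + 1))"
          unfolding q(2)[symmetric] j using p(1) by (simp only: int_pow_mult)
        also have "\<dots> = p" using p by simp
        finally show False using p z unfolding squares_def by blast
      qed
    next
      fix x assume "x \<in> carrier G" "x \<otimes> x = \<one>"
      then show "\<exists>c. x = combination (Suc 0) (\<lambda>_. p) c \<and> (\<forall>i\<ge>0. c i = 0)"
        using tor[of x] by (intro exI[of _ "\<lambda>_. 0"]) (auto simp: comb)
    qed (use p that in \<open>auto simp: comb\<close>)
    then show ?thesis by simp
  qed
  fix x :: int and y :: int
  assume x: "x \<in> carrier (integer_mod_group k)" and xy: "t [^] x \<otimes> p [^] y = \<one>"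
  \<comment> \<open>The k-th power kills the torsion factor and leaves a pure relation for
    \<open>p\<close>.\<close>
  have "\<one> = (t [^] x \<otimes> p [^] y) [^] int k" using xy by simp
  also have "\<dots> = (t [^] int k) [^] x \<otimes> p [^] (y * int k)"
    using t(1) p(1) by (simp add: int_pow_distrib int_pow_pow mult.commute)
  also have "\<dots> = p [^] (y * int k)" using t(1,2) p(1) by (simp add: int_pow_int)
  finally have "y = 0" using free[of "y * int k"] k by auto
  then have "t [^] x = \<one>" using xy t by simp
  then have "x = 0" using t(3) x k zero_if_one_integer_mod_group by blast
  with \<open>y = 0\<close> show "x = \<one>\<^bsub>integer_mod_group k\<^esub> \<and> y = \<one>\<^bsub>integer_group\<^esub>" by simp
qed (use t p k in \<open>auto intro: hom_integer_mod_group hom_integer_group_pow\<close>)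

lemma free_abelian_group_eq_one:
  assumes "y \<in> carrier (free_abelian_group_of_rank r)" "\<And>i. i < r \<Longrightarrow> y i = 0"
  shows "y = \<one>\<^bsub>free_abelian_group_of_rank r\<^esub>"
  using assms by (auto simp: PiE_iff extensional_def fun_eq_iff)

text \<open>\<open>g 0\<close> generates the torsion factor. It is listed among the independent
  elements because the descent divides by 2 up to 2-torsion, which consists of powers of
  \<open>g 0\<close>; the other exponents then vanish by \<open>relation_trivial\<close> with r =
  1.\<close>

lemma has_subgroup_cyclic_times_free:
  assumes g: "\<And>i. i \<le> r \<Longrightarrow> g i \<in> carrier G"
    and ev: "\<And>n i. combination (Suc r) g n \<in> squares \<Longrightarrow> i \<le> r \<Longrightarrow> even (n i)"
    and t: "g 0 [^] k = \<one>" "\<And>x::int. g 0 [^] x = \<one> \<Longrightarrow> int k dvd x" and k: "k > 0"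
    and tor: "\<And>x. x \<in> carrier G \<Longrightarrow> x \<otimes> x = \<one> \<Longrightarrow> \<exists>c::int. x = g 0 [^] c"
  shows "has_subgroup_isomorphic_to G (integer_mod_group k \<times>\<times> free_abelian_group_of_rank r)"
proof (rule has_subgroup_isomorphic_to_DirProd)
  let ?g = "\<lambda>i. g (Suc i)"
  fix x :: int and y :: "nat \<Rightarrow> int"
  assume x: "x \<in> carrier (integer_mod_group k)" and y: "y \<in> carrier (free_abelian_group_of_rank r)"
    and xy: "g 0 [^] x \<otimes> combination r ?g y = \<one>"
  have shift: "combination (Suc r) g n = g 0 [^] n 0 \<otimes> combination r ?g (\<lambda>i. n (Suc i))" for n
    using g by (intro combination_shift) auto
  define n where "n i = (case i of 0 \<Rightarrow> x | Suc i \<Rightarrow> y i)" for i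
  have n: "combination (Suc r) g n = \<one>" using xy by (simp add: shift n_def)
  have n0: "n i = 0" if "1 \<le> i" "i < Suc r" for i
  proof (rule relation_trivial[OF _ _ _ n that])
    fix z assume z: "z \<in> carrier G" "z \<otimes> z = \<one>"
    obtain c :: int where c: "z = g 0 [^] c" using tor[OF z] by blast
    let ?c = "\<lambda>i::nat. if i = 0 then c else 0"
    have c0: "combination r ?g (\<lambda>_. 0) = \<one>" unfolding combination_def by (rule finprod_one_eqI) simp
    have "combination (Suc r) g ?c = g 0 [^] c \<otimes> combination r ?g (\<lambda>_. 0)"
      unfolding shift by simp
    also have "\<dots> = z" unfolding c0 using c g[of 0] by simp
    finally have "z = combination (Suc r) g ?c \<and> (\<forall>i\<ge>1. ?c i = 0)" by simp
    then show "\<exists>c. z = combination (Suc r) g c \<and> (\<forall>i\<ge>1. c i = 0)" by (intro exI[of _ ?c])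
  qed (use g ev in auto)
  have y0: "y i = 0" if "i < r" for i using n0[of "Suc i"] that by (simp add: n_def)
  have "combination r ?g y = \<one>" unfolding combination_def by (rule finprod_one_eqI) (simp add: y0)
  then have "x = 0" using xy t(2) x k g zero_if_one_integer_mod_group by simp
  then show "x = \<one>\<^bsub>integer_mod_group k\<^esub> \<and> y = \<one>\<^bsub>free_abelian_group_of_rank r\<^esub>"
    using free_abelian_group_eq_one[OF y] y0 by simp
qed (use t g k in \<open>auto intro!: hom_integer_mod_group hom_product_group product_group\<close>)

text \<open>As before, with \<open>g 0\<close> of exponent 2 and \<open>g 1\<close> of order k
  carrying the 2-torsion together. The descent starts at index 2.\<close>

lemma has_subgroup_two_cyclic_times_free:
  assumes g: "\<And>i. i \<le> Suc r \<Longrightarrow> g i \<in> carrier G"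
    and ev: "\<And>n i. combination (Suc (Suc r)) g n \<in> squares \<Longrightarrow> i \<le> Suc r \<Longrightarrow> even (n i)"
    and s: "g 0 \<otimes> g 0 = \<one>"
    and t: "g 1 [^] k = \<one>" "\<And>x::int. g 1 [^] x = \<one> \<Longrightarrow> int k dvd x" and k: "k > 0"
    and tor: "\<And>x. x \<in> carrier G \<Longrightarrow> x \<otimes> x = \<one> \<Longrightarrow> \<exists>(c::int) (d::int). x = g 0 [^] c \<otimes> g 1 [^] d"
  shows "has_subgroup_isomorphic_to G
    (integer_mod_group 2 \<times>\<times> integer_mod_group k \<times>\<times> free_abelian_group_of_rank r)"
proof (rule has_subgroup_isomorphic_to_DirProd)
  let ?g = "\<lambda>i. g (Suc (Suc i))"
  let ?h = "\<lambda>(x, y). g 1 [^] (x::int) \<otimes> combination r ?g y"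
  have s2: "g 0 [^] (2::nat) = \<one>" using s g[of 0] by (simp add: numeral_2_eq_2)
  show "(\<lambda>x::int. g 0 [^] x) \<in> hom (integer_mod_group 2) G"
    using s2 g[of 0] by (intro hom_integer_mod_group) auto
  show "?h \<in> hom (integer_mod_group k \<times>\<times> free_abelian_group_of_rank r) G"
    using t g k by (intro hom_DirProd_mult hom_integer_mod_group hom_product_group) auto
  fix w :: int and xy :: "int \<times> (nat \<Rightarrow> int)"
  assume w: "w \<in> carrier (integer_mod_group 2)"
    and xy: "xy \<in> carrier (integer_mod_group k \<times>\<times> free_abelian_group_of_rank r)"
    and rel: "g 0 [^] w \<otimes> ?h xy = \<one>"
  obtain x y where xy_eq: "xy = (x, y)" by (cases xy)
  have x: "x \<in> carrier (integer_mod_group k)" and y: "y \<in> carrier (free_abelian_group_of_rank r)"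
    using xy xy_eq by auto
  have shift: "combination (Suc (Suc r)) g n = g 0 [^] n 0 \<otimes> (g 1 [^] n 1 \<otimes> combination r ?g (\<lambda>i. n (Suc (Suc i))))" for n
    using g by (subst combination_shift, simp, subst combination_shift) auto
  define n where "n i = (case i of 0 \<Rightarrow> w | Suc i \<Rightarrow> (case i of 0 \<Rightarrow> x | Suc i \<Rightarrow> y i))" for i
  have n: "combination (Suc (Suc r)) g n = \<one>" using rel by (simp add: shift n_def xy_eq)
  have n0: "n i = 0" if "2 \<le> i" "i < Suc (Suc r)" for i
  proof (rule relation_trivial[OF _ _ _ n that])
    fix z assume z: "z \<in> carrier G" "z \<otimes> z = \<one>"
    obtain c d :: int where c: "z = g 0 [^] c \<otimes> g 1 [^] d" using tor[OF z] by blast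
    let ?c = "\<lambda>i::nat. if i = 0 then c else if i = 1 then d else 0"
    have c0: "combination r ?g (\<lambda>_. 0) = \<one>" unfolding combination_def by (rule finprod_one_eqI) simp
    have "combination (Suc (Suc r)) g ?c = g 0 [^] c \<otimes> (g 1 [^] d \<otimes> combination r ?g (\<lambda>_. 0))"
      unfolding shift by simp
    also have "\<dots> = z" unfolding c0 using c g[of 1] by simp
    finally have "z = combination (Suc (Suc r)) g ?c \<and> (\<forall>i\<ge>2. ?c i = 0)" by simp
    then show "\<exists>c. z = combination (Suc (Suc r)) g c \<and> (\<forall>i\<ge>2. c i = 0)" by (intro exI[of _ ?c])
  qed (use g ev in auto)
  have y0: "y i = 0" if "i < r" for i using n0[of "Suc (Suc i)"] that by (simp add: n_def)
  have comb: "combination r ?g y = \<one>" unfolding combination_def by (rule finprod_one_eqI) (simp add: y0)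
  \<comment> \<open>The relation is itself a square, so its exponent at \<open>g 0\<close> is even;
    as a representative modulo 2 it is 0.\<close>
  have "\<one> \<in> squares" unfolding squares_def by force
  then have "even (n 0)" using ev[of n 0] n by simp
  then have "w = 0" using w by (auto simp: n_def carrier_integer_mod_group)
  moreover from this have "g 1 [^] x = \<one>" using rel comb xy_eq g[of 1] by simp
  then have "x = 0" using t(2) x k zero_if_one_integer_mod_group by blast
  ultimately show "w = \<one>\<^bsub>integer_mod_group 2\<^esub> \<and> xy = \<one>\<^bsub>integer_mod_group k \<times>\<times> free_abelian_group_of_rank r\<^esub>"
    using free_abelian_group_eq_one[OF y] y0 xy_eq by simp
qed (auto intro!: DirProd_group product_group)

end

section \<open>Mordell--Weil groups and two-descent\<close>

locale curve_over = cubic_curve +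
  fixes K :: "'a set"
  assumes K_one: "1 \<in> K" and K_add: "x \<in> K \<Longrightarrow> y \<in> K \<Longrightarrow> x + y \<in> K"
    and K_minus: "x \<in> K \<Longrightarrow> - x \<in> K" and K_mult: "x \<in> K \<Longrightarrow> y \<in> K \<Longrightarrow> x * y \<in> K"
    and K_inverse: "x \<in> K \<Longrightarrow> inverse x \<in> K"
    and K_coeffs: "a \<in> K" "b \<in> K" "c \<in> K"
begin

abbreviation "MW \<equiv> mordell_weil_group E K"

lemma K_diff: "x \<in> K \<Longrightarrow> y \<in> K \<Longrightarrow> x - y \<in> K"
  using K_add[of x "- y"] K_minus by simp

lemma K_divide: "x \<in> K \<Longrightarrow> y \<in> K \<Longrightarrow> x / y \<in> K"
  using K_mult[of x "inverse y"] K_inverse by (simp add: divide_inverse)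

lemma K_zero: "0 \<in> K"
  using K_diff[OF K_one K_one] by simp

lemma K_numeral: "numeral k \<in> K"
proof -
  have "of_nat n \<in> K" for n :: nat by (induction n) (auto intro: K_zero K_one K_add)
  from this[of "numeral k"] show ?thesis by simp
qed

lemma K_power: "x \<in> K \<Longrightarrow> x ^ n \<in> K"
  by (induction n) (auto intro: K_one K_mult)

lemmas K_intros = K_one K_zero K_add K_minus K_mult K_inverse K_diff K_divide K_numeral K_power K_coeffs

lemma carrier_MW: "carrier MW = {P. on_curve E P \<and> set_point P \<subseteq> K}"
  by (simp add: mordell_weil_group_def)

lemma mult_MW: "P \<otimes>\<^bsub>MW\<^esub> Q = point_add E P Q"
  by (simp add: mordell_weil_group_def)

lemma one_MW: "\<one>\<^bsub>MW\<^esub> = Infinity"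
  by (simp add: mordell_weil_group_def)

lemma add_in_K:
  assumes "set_point P \<subseteq> K" "set_point Q \<subseteq> K"
  shows "set_point (point_add E P Q) \<subseteq> K"
proof (cases P; cases Q)
  fix x1 y1 x2 y2 assume "P = Affine x1 y1" "Q = Affine x2 y2"
  with assms show ?thesis by (auto simp: point_add.simps(3) Let_def intro!: K_intros)
qed (use assms in simp_all)

lemma comm_group_MW: "comm_group MW"
proof (rule comm_groupI)
  fix P assume P: "P \<in> carrier MW"
  then have "neg_point P \<in> carrier MW" "point_add E (neg_point P) P = Infinity"
    using on_curve_neg[of P] add_neg[of "neg_point P"] K_minus by (cases P; auto simp: carrier_MW)+
  then show "\<exists>Q\<in>carrier MW. Q \<otimes>\<^bsub>MW\<^esub> P = \<one>\<^bsub>MW\<^esub>" by (auto simp: mult_MW one_MW)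
qed (auto simp: carrier_MW mult_MW one_MW on_curve_add point_add_assoc dest: add_in_K intro: add_commute)

text \<open>The 2-descent map x - e. At (e, 0), where x - e vanishes, it takes the value of the
  derivative of the cubic at e, that is the product of the differences of e from the other two
  roots; this keeps the map multiplicative modulo squares.\<close>

definition kummer :: "'a \<Rightarrow> 'a point \<Rightarrow> 'a" where
  "kummer e P = (case P of Infinity \<Rightarrow> 1 | Affine x y \<Rightarrow> if x = e then 3 * e\<^sup>2 + 2 * a * e + b else x - e)"

text \<open>The square root produced in \<open>kummer_add\<close> is l e + m, and it has to lie in
  \<open>K\<close> for the square class to be taken over \<open>K\<close>.\<close>

lemma slope_in_K:
  assumes "lin l m x1 x2 x3" "l * x1 + m \<in> K" "l * x2 + m \<in> K" "x1 \<in> K" "x2 \<in> K"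
  shows "l \<in> K" "m \<in> K"
proof -
  show l: "l \<in> K"
  proof (cases "x1 = x2")
    case False
    then have "l = (l * x2 + m - (l * x1 + m)) / (x2 - x1)" by (simp add: field_simps)
    then show ?thesis using assms by (metis K_diff K_divide)
  next
    case True
    have f: "x1 ^ 3 + a * x1\<^sup>2 + b * x1 + c = (l * x1 + m)\<^sup>2"
      using lin_factor[OF assms(1), of x1] by simp
    have d: "3 * x1\<^sup>2 + 2 * a * x1 + b = 2 * l * (l * x1 + m)"
      using lin_deriv[OF assms(1), of x1] True by simp
    have y0: "l * x1 + m \<noteq> 0" using nonsingular[of x1] f d by auto
    define t where "t = l * x1 + m"
    have t: "t \<in> K" using assms by (simp add: t_def)
    have "l = (3 * x1\<^sup>2 + 2 * a * x1 + b) / (2 * t)"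
      unfolding d using y0 by (simp flip: t_def)
    moreover have "(3 * x1\<^sup>2 + 2 * a * x1 + b) / (2 * t) \<in> K"
      using assms t by (intro K_intros)
    ultimately show ?thesis by (simp only:)
  qed
  have "m = (l * x1 + m) - l * x1" by simp
  then show "m \<in> K" using l assms by (metis K_diff K_mult)
qed

context
  fixes e
  assumes root: "e ^ 3 + a * e\<^sup>2 + b * e + c = 0" and e: "e \<in> K"
begin

lemma kummer_nonzero: "kummer e P \<noteq> 0"
  using nonsingular[OF root] by (simp add: kummer_def split: point.split)

lemma kummer_in_K: "set_point P \<subseteq> K \<Longrightarrow> kummer e P \<in> K"
  using e by (auto simp: kummer_def split: point.split intro!: K_intros)

text \<open>If P, Q, -(P + Q) lie on y = l x + m, evaluating the cubic minus (l x + m)^2 at its root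
  e gives the product of the three values x - e as (l e + m)^2. Multiplicativity is stated for this
  triple product because inverses do not matter modulo squares.\<close>

lemma kummer_add:
  assumes P: "P \<in> carrier MW" and Q: "Q \<in> carrier MW"
  shows "\<exists>z\<in>K. z \<noteq> 0 \<and> kummer e P * kummer e Q * kummer e (point_add E P Q) = z\<^sup>2"
proof (cases P; cases Q)
  fix x1 y1 x2 y2 assume PQ: "P = Affine x1 y1" "Q = Affine x2 y2"
  show ?thesis
  proof (cases "x1 = x2 \<and> y1 + y2 = 0")
    case True
    then have "kummer e P * kummer e Q * kummer e (point_add E P Q) = (kummer e P)\<^sup>2"
      using PQ by (simp add: add_opposite kummer_def power2_eq_square)
    then show ?thesis using kummer_nonzero[of P] kummer_in_K[of P] P by (auto simp: carrier_MW)
  next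
    case False
    have on: "on_curve E (Affine x1 y1)" "on_curve E (Affine x2 y2)" and
      inK: "x1 \<in> K" "y1 \<in> K" "x2 \<in> K" "y2 \<in> K"
      using P Q PQ by (simp_all add: carrier_MW)
    obtain l m x3 where L: "lin l m x1 x2 x3" "y1 = l * x1 + m" "y2 = l * x2 + m"
      "point_add E (Affine x1 y1) (Affine x2 y2) = Affine x3 (- (l * x3 + m))"
      using add_lin[OF on False] by blast
    have lm: "l \<in> K" "m \<in> K" using slope_in_K[OF L(1)] inK L(2,3) by simp_all
    let ?d = "3 * e\<^sup>2 + 2 * a * e + b"
    have d: "?d \<noteq> 0" using nonsingular[OF root] .
    have dK: "?d \<in> K" using e by (intro K_intros)
    have f: "(l * e + m)\<^sup>2 + (e - x1) * (e - x2) * (e - x3) = 0"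
      using lin_factor[OF L(1), of e] root by simp
    have D: "?d = 2 * l * (l * e + m) + (e - x1) * (e - x2) + (e - x1) * (e - x3) + (e - x2) * (e - x3)"
      using lin_deriv[OF L(1), of e] .
    have k: "kummer e (Affine x y) = (if x = e then ?d else x - e)" for x y by (simp add: kummer_def)
    have eq: "kummer e P * kummer e Q * kummer e (point_add E P Q) =
        (if x1 = e then ?d else x1 - e) * (if x2 = e then ?d else x2 - e) * (if x3 = e then ?d else x3 - e)"
      unfolding PQ L(4) k ..
    show ?thesis
    proof (cases "x1 = e \<or> x2 = e \<or> x3 = e")
      case False
      have "(x1 - e) * (x2 - e) * (x3 - e) = (l * e + m)\<^sup>2" using f by Groebner_Basis.algebra
      moreover have "l * e + m \<in> K" using lm e by (intro K_intros)
      moreover from False calculation(1) have "l * e + m \<noteq> 0" by auto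
      ultimately show ?thesis using False eq by auto
    next
      case True
      then have le: "l * e + m = 0" using f by auto
      \<comment> \<open>The line now passes through (e, 0). By the product rule the derivative of
        the cubic at e is the product of the two remaining differences, so the triple product is the
        square of that derivative.\<close>
      define t where "t = ?d"
      have t: "t = (e - x1) * (e - x2) + (e - x1) * (e - x3) + (e - x2) * (e - x3)"
        using D le by (simp add: t_def)
      have t0: "t \<noteq> 0" using d by (simp add: t_def)
      have sgn: "t * ((u - e) * (v - e)) = t * ((e - u) * (e - v))" for u v by (simp add: algebra_simps)
      consider "x1 = e" "t = (e - x2) * (e - x3)" | "x2 = e" "t = (e - x1) * (e - x3)"
        | "x3 = e" "t = (e - x1) * (e - x2)"
        using True t by auto
      then have "kummer e P * kummer e Q * kummer e (point_add E P Q) = t\<^sup>2"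
      proof cases
        case 1
        then have "x2 \<noteq> e" "x3 \<noteq> e" using t0 by auto
        with 1 have "kummer e P * kummer e Q * kummer e (point_add E P Q) = t * ((x2 - e) * (x3 - e))"
          unfolding eq t_def[symmetric] by simp
        then show ?thesis unfolding sgn 1(2)[symmetric] by (simp only: power2_eq_square)
      next
        case 2
        then have "x1 \<noteq> e" "x3 \<noteq> e" using t0 by auto
        with 2 have "kummer e P * kummer e Q * kummer e (point_add E P Q) = t * ((x1 - e) * (x3 - e))"
          unfolding eq t_def[symmetric] by simp
        then show ?thesis unfolding sgn 2(2)[symmetric] by (simp only: power2_eq_square)
      next
        case 3
        then have "x1 \<noteq> e" "x2 \<noteq> e" using t0 by auto
        with 3 have "kummer e P * kummer e Q * kummer e (point_add E P Q) = t * ((x1 - e) * (x2 - e))"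
          unfolding eq t_def[symmetric] by simp
        then show ?thesis unfolding sgn 3(2)[symmetric] by (simp only: power2_eq_square)
      qed
      then have "kummer e P * kummer e Q * kummer e (point_add E P Q) = ?d\<^sup>2" by (simp only: t_def)
      then show ?thesis using d dK by blast
    qed
  qed
next
  fix x y assume "P = Infinity" "Q = Affine x y"
  then show ?thesis using Q kummer_nonzero[of Q] kummer_in_K[of Q]
    by (intro bexI[of _ "kummer e Q"]) (auto simp: kummer_def carrier_MW power2_eq_square split: if_splits)
next
  fix x y assume "Q = Infinity" "P = Affine x y"
  then show ?thesis using P kummer_nonzero[of P] kummer_in_K[of P]
    by (intro bexI[of _ "kummer e P"]) (auto simp: kummer_def carrier_MW power2_eq_square split: if_splits)
next
  assume "P = Infinity" "Q = Infinity"
  then show ?thesis by (auto simp: kummer_def intro!: bexI[of _ 1] K_one)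
qed

text \<open>The preimage under the descent map of the classes represented in S. For suitable S it is
  the kernel of a residue symbol composed with that map; the factor z^2 absorbs
  denominators.\<close>

definition square_classes :: "'a set \<Rightarrow> 'a point set" where
  "square_classes S = {P \<in> carrier MW. \<exists>z\<in>K. \<exists>y\<in>S. z \<noteq> 0 \<and> kummer e P = z\<^sup>2 * y}"

lemma kummer_add':
  assumes P: "P \<in> carrier MW" and Q: "Q \<in> carrier MW"
  shows "\<exists>z\<in>K. z \<noteq> 0 \<and> kummer e (point_add E P Q) = z\<^sup>2 * (kummer e P * kummer e Q)"
proof -
  obtain z where z: "z \<in> K" "z \<noteq> 0" "kummer e P * kummer e Q * kummer e (point_add E P Q) = z\<^sup>2"
    using kummer_add[OF P Q] by blast
  let ?u = "z / (kummer e P * kummer e Q)"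
  have "?u \<in> K" using z P Q kummer_in_K by (auto simp: carrier_MW intro!: K_intros)
  moreover have "?u \<noteq> 0" using z kummer_nonzero by simp
  moreover have "kummer e (point_add E P Q) = ?u\<^sup>2 * (kummer e P * kummer e Q)"
    using z(3) kummer_nonzero[of P] kummer_nonzero[of Q] by (simp add: field_simps power2_eq_square)
  ultimately show ?thesis by blast
qed

lemma subgroup_square_classes:
  assumes "1 \<in> S" "\<And>x y. x \<in> S \<Longrightarrow> y \<in> S \<Longrightarrow> x * y \<in> S"
  shows "subgroup (square_classes S) MW" "monoid.squares MW \<subseteq> square_classes S"
proof -
  interpret comm_group MW by (rule comm_group_MW)
  show "squares \<subseteq> square_classes S"
  proof
    fix x assume "x \<in> squares"
    then obtain P where P: "P \<in> carrier MW" "x = point_add E P P" by (auto simp: squares_def mult_MW)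
    obtain z where z: "z \<in> K" "z \<noteq> 0" "kummer e x = z\<^sup>2 * (kummer e P * kummer e P)"
      using kummer_add'[OF P(1) P(1)] P(2) by blast
    have "z * kummer e P \<in> K" "z * kummer e P \<noteq> 0" "kummer e x = (z * kummer e P)\<^sup>2 * 1"
      using z kummer_in_K[of P] kummer_nonzero P by (auto simp: carrier_MW power2_eq_square intro: K_mult)
    moreover have "x \<in> carrier MW" using P m_closed by (simp add: mult_MW)
    ultimately show "x \<in> square_classes S" using assms(1) unfolding square_classes_def by blast
  qed
  show "subgroup (square_classes S) MW"
  proof (rule subgroupI)
    show "square_classes S \<subseteq> carrier MW" by (auto simp: square_classes_def)
    have "\<one>\<^bsub>MW\<^esub> \<in> square_classes S"
      using assms(1) one_closed K_one unfolding square_classes_def one_MW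
      by (auto simp: kummer_def intro!: bexI[of _ 1])
    then show "square_classes S \<noteq> {}" by blast
  next
    fix P assume "P \<in> square_classes S"
    then have P: "P \<in> carrier MW" "\<exists>z\<in>K. \<exists>y\<in>S. z \<noteq> 0 \<and> kummer e P = z\<^sup>2 * y"
      by (auto simp: square_classes_def)
    have n: "neg_point P \<in> carrier MW"
      using P(1) on_curve_neg[of P] K_minus by (cases P) (auto simp: carrier_MW)
    have "inv\<^bsub>MW\<^esub> P = neg_point P"
      using n P add_neg[of "neg_point P"] by (intro inv_equality) (auto simp: mult_MW one_MW)
    moreover have "kummer e (neg_point P) = kummer e P" by (cases P) (auto simp: kummer_def)
    ultimately show "inv\<^bsub>MW\<^esub> P \<in> square_classes S" using n P by (simp add: square_classes_def)
  next
    fix P Q assume "P \<in> square_classes S" "Q \<in> square_classes S"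
    then obtain zP yP zQ yQ where
      P: "P \<in> carrier MW" "zP \<in> K" "yP \<in> S" "zP \<noteq> 0" "kummer e P = zP\<^sup>2 * yP" and
      Q: "Q \<in> carrier MW" "zQ \<in> K" "yQ \<in> S" "zQ \<noteq> 0" "kummer e Q = zQ\<^sup>2 * yQ"
      by (auto simp: square_classes_def)
    obtain z where z: "z \<in> K" "z \<noteq> 0" "kummer e (point_add E P Q) = z\<^sup>2 * (kummer e P * kummer e Q)"
      using kummer_add'[OF P(1) Q(1)] by blast
    have "kummer e (point_add E P Q) = (z * zP * zQ)\<^sup>2 * (yP * yQ)"
      unfolding z(3) P(5) Q(5) by (simp add: power2_eq_square)
    moreover have "z * zP * zQ \<in> K" "z * zP * zQ \<noteq> 0" "yP * yQ \<in> S"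
      using z P Q assms(2) by (auto intro: K_mult)
    ultimately show "P \<otimes>\<^bsub>MW\<^esub> Q \<in> square_classes S"
      using m_closed[OF P(1) Q(1)] unfolding square_classes_def mult_MW by blast
  qed
qed

end

section \<open>Two-torsion points and halving\<close>

lemma two_torsion:
  assumes "P \<in> carrier MW" "P \<otimes>\<^bsub>MW\<^esub> P = \<one>\<^bsub>MW\<^esub>" "P \<noteq> Infinity"
  obtains x where "P = Affine x 0" "x ^ 3 + a * x\<^sup>2 + b * x + c = 0" "x \<in> K"
proof -
  obtain x y where P: "P = Affine x y" using assms(3) by (cases P) auto
  have "y = 0"
  proof (rule ccontr)
    assume "y \<noteq> 0"
    then have "\<not> (x = x \<and> y + y = 0)" by simp
    moreover have on: "on_curve E (Affine x y)" using assms(1) P by (simp add: carrier_MW)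
    ultimately obtain x3 y3 where "point_add E (Affine x y) (Affine x y) = Affine x3 y3"
      using add_lin[OF on on] by blast
    then show False using assms(2) P by (simp add: mult_MW one_MW)
  qed
  then show ?thesis using that P assms(1) by (auto simp: carrier_MW)
qed

text \<open>The halving quartic: its roots include the abscissas of all halves of a point with
  abscissa x'. It arises by squaring the tangent slope equation and eliminating y.\<close>

lemma double_x:
  assumes "on_curve E (Affine x y)" "point_add E (Affine x y) (Affine x y) = Affine x' y'"
  shows "x ^ 4 - 2 * b * x\<^sup>2 - 8 * c * x + b\<^sup>2 - 4 * a * c - 4 * x' * (x ^ 3 + a * x\<^sup>2 + b * x + c) = 0"
proof -
  have y: "y \<noteq> 0"
  proof
    assume "y = 0"
    then have "point_add E (Affine x y) (Affine x y) = Infinity" by (simp add: add_opposite)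
    then show False using assms by simp
  qed
  define l where "l = (3 * x\<^sup>2 + 2 * a * x + b) / (2 * y)"
  have l: "l * (2 * y) = 3 * x\<^sup>2 + 2 * a * x + b" using y by (simp add: l_def)
  have x': "x' = l\<^sup>2 - a - x - x" using add_tangent[OF y l refl] assms(2) by simp
  have on: "y\<^sup>2 = x ^ 3 + a * x\<^sup>2 + b * x + c" using assms(1) by simp
  have "(l * (2 * y))\<^sup>2 = 4 * (x' + a + 2 * x) * (x ^ 3 + a * x\<^sup>2 + b * x + c)"
    unfolding on[symmetric] x' by (simp add: power2_eq_square algebra_simps)
  then show ?thesis unfolding l by (simp add: power2_eq_square power3_eq_cube power4_eq_xxxx algebra_simps)
qed

end

section \<open>Quadratic fields and reduction modulo split primes\<close>

lemma rat_square_int: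
  fixes q :: rat
  assumes "q\<^sup>2 = of_int D"
  shows "\<exists>u. u\<^sup>2 = D"
proof -
  obtain u n where q: "quotient_of q = (u, n)" by (cases "quotient_of q")
  have n: "n > 0" "coprime u n" using q quotient_of_denom_pos quotient_of_coprime by blast+
  have "q = of_int u / of_int n" using q quotient_of_div by blast
  then have "of_int (u\<^sup>2) = (of_int (D * n\<^sup>2) :: rat)"
    using assms n by (simp add: power_divide divide_eq_eq)
  then have u: "u\<^sup>2 = D * n\<^sup>2" by (simp only: of_int_eq_iff)
  then have "n dvd u\<^sup>2" by (simp add: power2_eq_square)
  moreover have "coprime n (u\<^sup>2)" using n(2) by (simp add: coprime_commute)
  ultimately have "n dvd 1" using coprime_common_divisor[of n "u\<^sup>2" n] by simp
  then have "n = 1" using n by simp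
  then show ?thesis using u by auto
qed

lemma not_square_int:
  fixes D k :: int
  assumes "k \<ge> 0" "k\<^sup>2 < D" "D < (k + 1)\<^sup>2"
  shows "u\<^sup>2 \<noteq> D"
proof
  assume u: "u\<^sup>2 = D"
  show False
  proof (cases "\<bar>u\<bar> \<le> k")
    case True
    then have "\<bar>u\<bar>\<^sup>2 \<le> k\<^sup>2" by (intro power_mono) auto
    then show False using u assms by simp
  next
    case False
    then have "(k + 1)\<^sup>2 \<le> \<bar>u\<bar>\<^sup>2" using assms by (intro power_mono) auto
    then show False using u assms by simp
  qed
qed

locale quadratic =
  fixes D :: int
  assumes nonsquare: "u\<^sup>2 \<noteq> D"
begin

definition w :: complex where "w = csqrt (of_int D)"

text \<open>A normal form for elements of the field: by \<open>mk_eq_iff\<close> equality is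
  equality of rational coordinates, so \<open>mk_simps\<close> decides all numerical identities
  about the four curves.\<close>

definition mk :: "rat \<Rightarrow> rat \<Rightarrow> complex" where "mk p q = of_rat p + of_rat q * w"

definition F :: "complex set" where "F = {mk p q |p q. True}"

lemma w_sq: "w * w = of_int D"
  unfolding w_def using power2_csqrt[of "of_int D"] by (simp only: power2_eq_square)

lemma of_rat_neq_w: "of_rat q \<noteq> w"
proof
  assume "of_rat q = w"
  then have "of_rat (q\<^sup>2) = (of_rat (of_int D) :: complex)"
    using w_sq by (simp add: of_rat_mult power2_eq_square)
  then have "q\<^sup>2 = of_int D" by (simp only: of_rat_eq_iff)
  then show False using rat_square_int nonsquare by blast
qed

lemma mk_eq_iff: "mk p q = mk p' q' \<longleftrightarrow> p = p' \<and> q = q'"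
proof
  assume eq: "mk p q = mk p' q'"
  have "q = q'"
  proof (rule ccontr)
    assume ne: "q \<noteq> q'"
    have "of_rat (q - q') * w = of_rat (p' - p)"
      using eq by (simp add: mk_def of_rat_diff algebra_simps)
    then have "w = of_rat ((p' - p) / (q - q'))"
      using ne by (simp add: of_rat_divide of_rat_diff field_simps)
    then show False using of_rat_neq_w by metis
  qed
  then show "p = p' \<and> q = q'" using eq by (simp add: mk_def)
qed simp

lemma mk_add: "mk p q + mk p' q' = mk (p + p') (q + q')"
  by (simp add: mk_def of_rat_add algebra_simps)

lemma mk_minus: "- mk p q = mk (- p) (- q)"
  by (simp add: mk_def of_rat_minus)

lemma mk_diff: "mk p q - mk p' q' = mk (p - p') (q - q')"
  by (simp add: mk_def of_rat_diff algebra_simps)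

lemma mk_mult: "mk p q * mk p' q' = mk (p * p' + of_int D * q * q') (p * q' + q * p')"
proof -
  have "mk p q * mk p' q' = of_rat p * of_rat p' + of_rat q * of_rat q' * (w * w) +
      (of_rat p * of_rat q' + of_rat q * of_rat p') * w"
    by (simp add: mk_def algebra_simps)
  then show ?thesis unfolding w_sq by (simp add: mk_def of_rat_add of_rat_mult algebra_simps)
qed

lemma numeral_mk: "numeral k = mk (numeral k) 0"
  by (simp add: mk_def)

lemma of_int_mk: "of_int k = mk (of_int k) 0"
  by (simp add: mk_def)

lemma one_mk: "1 = mk 1 0" and zero_mk: "0 = mk 0 0"
  by (simp_all add: mk_def)

lemma mk_eq_0_iff: "mk p q = 0 \<longleftrightarrow> p = 0 \<and> q = 0"
  unfolding zero_mk by (rule mk_eq_iff)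

lemmas mk_simps = mk_add mk_minus mk_diff mk_mult numeral_mk mk_eq_iff mk_eq_0_iff power2_eq_square power3_eq_cube

lemma mk_norm:
  fixes p q :: rat
  assumes "p \<noteq> 0 \<or> q \<noteq> 0"
  shows "p\<^sup>2 - of_int D * q\<^sup>2 \<noteq> 0"
proof
  assume eq: "p\<^sup>2 - of_int D * q\<^sup>2 = 0"
  show False
  proof (cases "q = 0")
    case False
    then have "(p / q)\<^sup>2 = of_int D" using eq by (simp add: field_simps)
    then show False using rat_square_int nonsquare by blast
  qed (use eq assms in auto)
qed

lemma inverse_mk: "inverse (mk p q) = mk (p / (p\<^sup>2 - of_int D * q\<^sup>2)) (- q / (p\<^sup>2 - of_int D * q\<^sup>2))"
proof (cases "p = 0 \<and> q = 0")
  case False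
  then have n: "p\<^sup>2 - of_int D * q\<^sup>2 \<noteq> 0" using mk_norm by blast
  have "mk p q * mk (p / (p\<^sup>2 - of_int D * q\<^sup>2)) (- q / (p\<^sup>2 - of_int D * q\<^sup>2)) = mk 1 0"
    unfolding mk_mult mk_eq_iff using n by (simp add: divide_simps) (simp add: power2_eq_square algebra_simps)
  then show ?thesis unfolding one_mk[symmetric] by (rule inverse_unique)
next
  case True
  then show ?thesis by (simp add: zero_mk[symmetric])
qed

lemma mk_in_F: "mk p q \<in> F"
  by (auto simp: F_def)

lemma F_closed:
  "1 \<in> F" "x \<in> F \<Longrightarrow> y \<in> F \<Longrightarrow> x + y \<in> F" "x \<in> F \<Longrightarrow> - x \<in> F"
  "x \<in> F \<Longrightarrow> y \<in> F \<Longrightarrow> x * y \<in> F" "x \<in> F \<Longrightarrow> inverse x \<in> F"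
proof -
  have F: "x \<in> F \<Longrightarrow> \<exists>p q. x = mk p q" for x by (auto simp: F_def)
  show "1 \<in> F" unfolding one_mk by (rule mk_in_F)
  show "x \<in> F \<Longrightarrow> y \<in> F \<Longrightarrow> x + y \<in> F" "x \<in> F \<Longrightarrow> y \<in> F \<Longrightarrow> x * y \<in> F"
    using mk_in_F by (auto dest!: F simp: mk_add mk_mult)
  show "x \<in> F \<Longrightarrow> - x \<in> F" "x \<in> F \<Longrightarrow> inverse x \<in> F"
    using mk_in_F by (auto dest!: F simp: mk_minus inverse_mk simp del: minus_divide_left)
qed

text \<open>The dimension is counted along the chain of line extensions from 0 over the rationals,
  by 1 and then by \<open>w\<close>, which is irrational since D is not a square.\<close>

lemma quadratic_number_field_F: "quadratic_number_field F"
proof -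
  let ?R = "ring_of_type_algebra :: complex ring"
  interpret R: field ?R by (rule field_from_type_algebra)
  have inv: "inv\<^bsub>?R\<^esub> x = inverse x" if "x \<noteq> 0" for x
    using that by (intro R.comm_inv_char) (auto simp: ring_of_type_algebra_def)
  have sub: "subfield A ?R" if "1 \<in> A" "\<And>x y. x \<in> A \<Longrightarrow> y \<in> A \<Longrightarrow> x + y \<in> A" "\<And>x. x \<in> A \<Longrightarrow> - x \<in> A"
    "\<And>x y. x \<in> A \<Longrightarrow> y \<in> A \<Longrightarrow> x * y \<in> A" "\<And>x. x \<in> A \<Longrightarrow> inverse x \<in> A" for A
  proof (rule R.subfieldI')
    have "\<ominus>\<^bsub>?R\<^esub> x = - x" for x
      by (rule R.minus_equality) (auto simp: ring_of_type_algebra_def)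
    then show "subring A ?R"
      using that by (intro R.subringI) (auto simp: ring_of_type_algebra_def)
    show "inv\<^bsub>?R\<^esub> k \<in> A" if "k \<in> A - {\<zero>\<^bsub>?R\<^esub>}" for k
      using that \<open>\<And>x. x \<in> A \<Longrightarrow> inverse x \<in> A\<close> inv by (auto simp: ring_of_type_algebra_def)
  qed
  have F: "subfield F ?R" using F_closed by (intro sub)
  have Q: "subfield \<rat> ?R" by (intro sub) auto
  have ext: "R.line_extension \<rat> v A = {k * v + y |k y. k \<in> \<rat> \<and> y \<in> A}" for v A
    unfolding set_eq_iff R.line_extension_mem_iff by (auto simp: ring_of_type_algebra_def)
  have 1: "R.line_extension \<rat> 1 {0} = \<rat>" by (auto simp: ext)
  have 2: "R.line_extension \<rat> w \<rat> = F"
  proof -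
    have "k * w + y \<in> F" if "k \<in> \<rat>" "y \<in> \<rat>" for k y
    proof -
      from that obtain q p where "k = of_rat q" "y = of_rat p" by (auto elim!: Rats_cases)
      then have "k * w + y = mk p q" by (simp add: mk_def)
      then show ?thesis using mk_in_F by simp
    qed
    moreover have "\<exists>k y. mk p q = k * w + y \<and> k \<in> \<rat> \<and> y \<in> \<rat>" for p q
      by (intro exI[of _ "of_rat q"] exI[of _ "of_rat p"]) (simp add: mk_def)
    ultimately show ?thesis unfolding ext F_def by blast
  qed
  have "R.dimension 0 \<rat> {\<zero>\<^bsub>?R\<^esub>}" by (rule R.dimension.zero_dim)
  then have "R.dimension 0 \<rat> {0}" by (simp add: ring_of_type_algebra_def)
  then have "R.dimension (Suc 0) \<rat> (R.line_extension \<rat> 1 {0})"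
    by (intro R.dimension.Suc_dim) (auto simp: ring_of_type_algebra_def)
  moreover have "w \<notin> \<rat>"
  proof
    assume "w \<in> \<rat>"
    then obtain q where "w = of_rat q" by (rule Rats_cases)
    then show False using of_rat_neq_w[of q] by simp
  qed
  ultimately have "R.dimension (Suc (Suc 0)) \<rat> (R.line_extension \<rat> w \<rat>)"
    unfolding 1 by (intro R.dimension.Suc_dim) (auto simp: ring_of_type_algebra_def)
  then show ?thesis using F unfolding quadratic_number_field_def 2 by (simp add: numeral_2_eq_2)
qed

lemma F_int: assumes "z \<in> F" shows "\<exists>u v n. n > 0 \<and> of_int n * z = of_int u + of_int v * w"
proof -
  obtain p q where z: "z = mk p q" using assms by (auto simp: F_def)
  obtain u n where p: "quotient_of p = (u, n)" by (cases "quotient_of p")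
  obtain v m where q: "quotient_of q = (v, m)" by (cases "quotient_of q")
  have nm: "n > 0" "m > 0" using p q quotient_of_denom_pos by blast+
  have pq: "p = of_int u / of_int n" "q = of_int v / of_int m" using p q quotient_of_div by blast+
  have p': "of_int n * of_rat p = (of_int u :: complex)" and q': "of_int m * of_rat q = (of_int v :: complex)"
    using nm by (simp_all add: pq of_rat_divide)
  have "of_int (n * m) * z = (of_int n * of_rat p) * of_int m + (of_int m * of_rat q) * of_int n * w"
    unfolding z mk_def by (simp add: algebra_simps)
  then have "of_int (n * m) * z = of_int (u * m) + of_int (v * n) * w"
    unfolding p' q' of_int_mult .
  then show ?thesis using nm by (intro exI[of _ "u * m"] exI[of _ "v * n"] exI[of _ "n * m"] conjI) simp_all
qed

lemma int_coords: assumes "of_int u + of_int v * w = of_int u' + of_int v' * w" shows "u = u'" "v = v'"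
proof -
  have "mk (of_int u) (of_int v) = mk (of_int u') (of_int v')" using assms by (simp add: mk_def)
  then show "u = u'" "v = v'" by (simp_all add: mk_eq_iff)
qed

lemma int_mult: "(of_int u + of_int v * w) * (of_int u' + of_int v' * w) =
    of_int (u * u' + D * v * v') + of_int (u * v' + v * u') * w"
  using mk_mult[of "of_int u" "of_int v" "of_int u'" "of_int v'"] by (simp add: mk_def of_rat_add of_rat_mult)

end

section \<open>Reduction at a prime above p\<close>

locale place = quadratic +
  fixes p s :: int
  assumes prime: "prime p" and odd: "p \<noteq> 2" and s: "[s * s = D] (mod p)" and ndvd: "\<not> p dvd D"
begin

text \<open>Reduction sends \<open>w\<close> to \<open>s\<close>; the choice of s or -s selects one
  of the two primes above p. It is a relation because it is defined only for elements with a
  denominator prime to p in the basis 1, \<open>w\<close>, that is for elements integral at both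
  primes.\<close>

definition red :: "complex \<Rightarrow> int \<Rightarrow> bool" where
  "red z r \<longleftrightarrow> (\<exists>u v n. \<not> p dvd n \<and> of_int n * z = of_int u + of_int v * w \<and> [n * r = u + v * s] (mod p))"

lemma p_dvd_mult: "p dvd x * y \<longleftrightarrow> p dvd x \<or> p dvd y"
  using prime by (simp add: prime_dvd_mult_iff)

lemma red_int: "red (of_int u + of_int v * w) (u + v * s)"
  unfolding red_def using prime by (intro exI[of _ u] exI[of _ v] exI[of _ 1]) (auto simp: not_prime_unit zdvd1_eq)

lemma red_mult: assumes "red z r" "red z' r'" shows "red (z * z') (r * r')"
proof -
  from assms obtain u v n u' v' n' where
    1: "\<not> p dvd n" "of_int n * z = of_int u + of_int v * w" "[n * r = u + v * s] (mod p)" and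
    2: "\<not> p dvd n'" "of_int n' * z' = of_int u' + of_int v' * w" "[n' * r' = u' + v' * s] (mod p)"
    unfolding red_def by blast
  have "of_int (n * n') * (z * z') = (of_int n * z) * (of_int n' * z')" by simp
  then have e: "of_int (n * n') * (z * z') = of_int (u * u' + D * v * v') + of_int (u * v' + v * u') * w"
    unfolding 1(2) 2(2) int_mult .
  have "[(n * r) * (n' * r') = (u + v * s) * (u' + v' * s)] (mod p)" by (rule cong_mult[OF 1(3) 2(3)])
  moreover have "[(u + v * s) * (u' + v' * s) = u * u' + D * v * v' + (u * v' + v * u') * s] (mod p)"
  proof -
    have "(u + v * s) * (u' + v' * s) = u * u' + (u * v' + v * u') * s + (v * v') * (s * s)"
      by (simp add: algebra_simps)
    also have "[\<dots> = u * u' + (u * v' + v * u') * s + (v * v') * D] (mod p)"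
      by (intro cong_add cong_mult s cong_refl)
    finally show ?thesis by (simp add: algebra_simps)
  qed
  ultimately have "[n * n' * (r * r') = u * u' + D * v * v' + (u * v' + v * u') * s] (mod p)"
    by (metis (no_types, lifting) cong_trans mult.assoc mult.left_commute)
  then show ?thesis using 1(1) 2(1) e p_dvd_mult unfolding red_def by blast
qed

lemma red_add: assumes "red z r" "red z' r'" shows "red (z + z') (r + r')"
proof -
  from assms obtain u v n u' v' n' where
    1: "\<not> p dvd n" "of_int n * z = of_int u + of_int v * w" "[n * r = u + v * s] (mod p)" and
    2: "\<not> p dvd n'" "of_int n' * z' = of_int u' + of_int v' * w" "[n' * r' = u' + v' * s] (mod p)"
    unfolding red_def by blast
  have "of_int (n * n') * (z + z') = of_int n' * (of_int n * z) + of_int n * (of_int n' * z')"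
    by (simp add: algebra_simps)
  then have e: "of_int (n * n') * (z + z') = of_int (n' * u + n * u') + of_int (n' * v + n * v') * w"
    unfolding 1(2) 2(2) by (simp add: algebra_simps)
  have "[n' * (n * r) + n * (n' * r') = n' * (u + v * s) + n * (u' + v' * s)] (mod p)"
    by (intro cong_add cong_mult cong_refl 1(3) 2(3))
  then have "[n * n' * (r + r') = n' * u + n * u' + (n' * v + n * v') * s] (mod p)"
    by (simp add: algebra_simps)
  then show ?thesis using 1(1) 2(1) e p_dvd_mult unfolding red_def by blast
qed

lemma red_unique: assumes "red z r" "red z r'" shows "[r = r'] (mod p)"
proof -
  from assms obtain u v n u' v' n' where
    1: "\<not> p dvd n" "of_int n * z = of_int u + of_int v * w" "[n * r = u + v * s] (mod p)" and
    2: "\<not> p dvd n'" "of_int n' * z = of_int u' + of_int v' * w" "[n' * r' = u' + v' * s] (mod p)"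
    unfolding red_def by blast
  have "of_int n' * (of_int u + of_int v * w) = of_int n * (of_int u' + of_int v' * w)"
    unfolding 1(2)[symmetric] 2(2)[symmetric] by simp
  then have "of_int (n' * u) + of_int (n' * v) * w = of_int (n * u') + of_int (n * v') * w"
    by (simp add: algebra_simps)
  from int_coords[OF this] have uv: "n' * u = n * u'" "n' * v = n * v'" .
  have "n' * (u + v * s) = n' * u + (n' * v) * s" "n * (u' + v' * s) = n * u' + (n * v') * s"
    by (simp_all add: algebra_simps)
  then have "n' * (u + v * s) = n * (u' + v' * s)" using uv by simp
  then have "[n' * (n * r) = n * (n' * r')] (mod p)"
    using cong_mult[OF cong_refl[of n' p] 1(3)] cong_mult[OF cong_refl[of n p] 2(3)]
    by (metis cong_sym cong_trans)
  then have "p dvd n * n' * (r - r')" by (simp add: cong_iff_dvd_diff algebra_simps)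
  then show ?thesis using 1(1) 2(1) p_dvd_mult by (simp add: cong_iff_dvd_diff)
qed

text \<open>A least positive denominator is prime to p: otherwise the hypothesis lets p be cancelled
  from denominator and numerators. Division by it modulo p then gives the residue.\<close>

lemma integral_if_red:
  assumes z: "z \<in> F" and int: "\<And>u v n. p dvd n \<Longrightarrow> of_int n * z = of_int u + of_int v * w \<Longrightarrow> p dvd u \<and> p dvd v"
  shows "\<exists>r. red z r"
proof -
  define Q where "Q n \<longleftrightarrow> n > 0 \<and> (\<exists>u v. of_int (int n) * z = of_int u + of_int v * w)" for n :: nat
  have "\<exists>n. Q n"
  proof -
    obtain u v n where "n > 0" "of_int n * z = of_int u + of_int v * w" using F_int[OF z] by blast
    then have "Q (nat n)" by (auto simp: Q_def)
    then show ?thesis ..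
  qed
  then have n: "Q (LEAST n. Q n)" by (rule LeastI_ex)
  define n where "n = (LEAST n. Q n)"
  obtain N u v where N: "N = int n" and uv: "N > 0" "of_int N * z = of_int u + of_int v * w"
    using n by (auto simp: Q_def n_def)
  have p0: "p > 1" using prime prime_gt_1_int by blast
  have "\<not> p dvd N"
  proof
    assume "p dvd N"
    with int[OF this uv(2)] obtain n' u' v' where p: "N = p * n'" "u = p * u'" "v = p * v'" by (auto elim!: dvdE)
    have "of_int p * (of_int n' * z) = of_int p * (of_int u' + of_int v' * w)"
      using uv(2) unfolding p by (simp add: algebra_simps)
    then have "of_int n' * z = of_int u' + of_int v' * w" using p0 by simp
    moreover have n': "n' > 0" using p(1) uv(1) p0 by (simp add: zero_less_mult_iff)
    ultimately have "Q (nat n')" by (auto simp: Q_def)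
    then have "n \<le> nat n'" unfolding n_def by (rule Least_le)
    then have "N \<le> n'" using n' N by simp
    moreover have "n' < p * n'" using p0 n' by simp
    ultimately show False using p(1) by simp
  qed
  moreover from this have "coprime N p" using prime_imp_coprime[OF prime, of N] by (simp add: coprime_commute)
  then obtain i where "[N * i = 1] (mod p)" using cong_solve_coprime_int by blast
  then have "[N * i * (u + v * s) = 1 * (u + v * s)] (mod p)" by (rule cong_scalar_right)
  then have "[N * (i * (u + v * s)) = u + v * s] (mod p)" by (simp only: mult.assoc mult_1)
  ultimately show ?thesis using uv(2) unfolding red_def by blast
qed

text \<open>A root of an integral square is integral: if p divides a denominator n of z = (u + v
  w)/n, comparing coordinates in z^2 shows that p divides u^2 + D v^2 and 2 u v. As p is odd and
  prime to D, it divides u and v.\<close>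

lemma red_square:
  assumes "z \<in> F" "red (z\<^sup>2) r"
  shows "\<exists>t. [r = t\<^sup>2] (mod p)"
proof -
  from assms(2) obtain u0 v0 n0 where
    0: "\<not> p dvd n0" "of_int n0 * z\<^sup>2 = of_int u0 + of_int v0 * w" unfolding red_def by blast
  have "\<exists>t. red z t"
  proof (rule integral_if_red[OF assms(1)])
    fix u v n assume n: "p dvd n" "of_int n * z = of_int u + of_int v * w"
    have "of_int (n * n) * (of_int u0 + of_int v0 * w) = of_int n0 * ((of_int n * z) * (of_int n * z))"
      unfolding 0(2)[symmetric] by (simp add: power2_eq_square)
    then have "of_int (n * n * u0) + of_int (n * n * v0) * w =
        of_int (n0 * (u * u + D * v * v)) + of_int (n0 * (u * v + v * u)) * w"
      unfolding n(2) int_mult by (simp add: algebra_simps)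
    from int_coords[OF this] have "n * n * u0 = n0 * (u * u + D * v * v)" "n * n * v0 = n0 * (2 * (u * v))"
      by (simp_all add: algebra_simps)
    then have "p dvd n0 * (u * u + D * v * v)" "p dvd n0 * (2 * (u * v))"
      using n(1) by (metis dvd_mult2)+
    moreover have "\<not> p dvd 2"
      using zdvd_imp_le[of p 2] prime_ge_2_int[OF prime] odd by auto
    ultimately have "p dvd u * u + D * v * v" "p dvd u \<or> p dvd v" using 0(1) p_dvd_mult by auto
    then show "p dvd u \<and> p dvd v"
    proof (elim disjE)
      assume "p dvd u"
      moreover from this have "p dvd D * v * v" using \<open>p dvd u * u + D * v * v\<close> by (simp add: dvd_add_right_iff)
      ultimately show ?thesis using ndvd p_dvd_mult by auto
    next
      assume "p dvd v"
      moreover from this have "p dvd u * u" using \<open>p dvd u * u + D * v * v\<close> by (simp add: dvd_add_left_iff)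
      ultimately show ?thesis using p_dvd_mult by auto
    qed
  qed
  then obtain t where "red z t" by blast
  from red_unique[OF assms(2)] red_mult[OF this this] have "[r = t\<^sup>2] (mod p)" by (simp add: power2_eq_square)
  then show ?thesis by blast
qed

text \<open>Elements with trivial residue symbol at the place: they reduce to a nonzero
  square.\<close>

definition S :: "complex set" where "S = {y. \<exists>r. red y (r\<^sup>2) \<and> \<not> p dvd r}"

lemma S_one: "1 \<in> S"
  unfolding S_def using red_int[of 1 0] prime by (auto simp: zdvd1_eq not_prime_unit intro!: exI[of _ 1])

lemma S_mult: "x \<in> S \<Longrightarrow> y \<in> S \<Longrightarrow> x * y \<in> S"
proof -
  assume "x \<in> S" "y \<in> S"
  then obtain r r' where r: "red x (r\<^sup>2)" "\<not> p dvd r" "red y (r'\<^sup>2)" "\<not> p dvd r'" by (auto simp: S_def)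
  have "red (x * y) ((r * r')\<^sup>2)" using red_mult[OF r(1,3)] by (simp only: power_mult_distrib)
  then show ?thesis unfolding S_def using r(2,4) p_dvd_mult by blast
qed

text \<open>If y and y' represent the same square class, y y' is a square in \<open>F\<close>. With
  y reducing to a nonzero square this forces the residue q of y' to be a square as well.\<close>

lemma not_in_S:
  assumes "y' \<in> F" "z \<in> F" "z \<noteq> 0" "z' \<in> F" "red y' q" "\<And>t. \<not> [q = t\<^sup>2] (mod p)" "z'\<^sup>2 * y' = z\<^sup>2 * y"
  shows "y \<notin> S"
proof
  assume "y \<in> S"
  then obtain r where r: "red y (r\<^sup>2)" "\<not> p dvd r" by (auto simp: S_def)
  have "y * y' = (z' * y' * inverse z)\<^sup>2"
    using assms(3,7) by (simp add: field_simps power2_eq_square)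
  then have "red ((z' * y' * inverse z)\<^sup>2) (r\<^sup>2 * q)" using red_mult[OF r(1) assms(5)] by simp
  moreover have "z' * y' * inverse z \<in> F" using assms(1,2,4) by (intro F_closed)
  ultimately obtain t where t: "[r\<^sup>2 * q = t\<^sup>2] (mod p)" using red_square by blast
  have "coprime r p" using prime_imp_coprime[OF prime r(2)] by (simp add: coprime_commute)
  then obtain i where i: "[r * i = 1] (mod p)" using cong_solve_coprime_int by blast
  have "[(r * i)\<^sup>2 * q = 1\<^sup>2 * q] (mod p)" by (intro cong_mult cong_pow i cong_refl)
  moreover have "[(r * i)\<^sup>2 * q = (t * i)\<^sup>2] (mod p)"
    using cong_mult[OF t cong_refl[of "i\<^sup>2" p]] by (simp add: power_mult_distrib algebra_simps)
  ultimately show False using assms(6) by (metis cong_sym cong_trans mult_1 power_one)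
qed

lemma red_cong: assumes "red z r" "[r = r'] (mod p)" shows "red z r'"
proof -
  from assms(1) obtain u v n where
    1: "\<not> p dvd n" "of_int n * z = of_int u + of_int v * w" "[n * r = u + v * s] (mod p)"
    unfolding red_def by blast
  have "[n * r' = n * r] (mod p)" by (intro cong_mult cong_refl cong_sym[OF assms(2)])
  then show ?thesis using 1 cong_trans unfolding red_def by blast
qed

lemma red_minus: "red z r \<Longrightarrow> red (- z) (- r)"
  using red_mult[of "-1" "-1" z r] red_int[of "-1" 0] by simp

lemma red_diff: "red z r \<Longrightarrow> red z' r' \<Longrightarrow> red (z - z') (r - r')"
  using red_add[of z r "- z'" "- r'"] red_minus[of z' r'] by simp

lemma red_power: "red z r \<Longrightarrow> red (z ^ k) (r ^ k)"
  using red_int[of 1 0] by (induction k) (auto intro: red_mult)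

lemma red_numeral: "red (numeral k) (numeral k)"
  using red_int[of "numeral k" 0] by simp

lemma red_0: "red 0 r \<Longrightarrow> p dvd r"
  using red_unique[of 0 r 0] red_int[of 0 0] by (simp add: cong_0_iff)

lemma red_int_coeff: "[u + v * s = r] (mod p) \<Longrightarrow> red (of_int u + of_int v * w) r"
  using red_cong red_int by blast

lemma place_conj: "place D p (- s)"
  using prime odd s ndvd nonsquare by unfold_locales auto

lemma place_neg_s: "\<not> p dvd 2 * s"
proof
  assume "p dvd 2 * s"
  moreover have "\<not> p dvd 2" using zdvd_imp_le[of p 2] prime_ge_2_int[OF prime] odd by auto
  ultimately have "p dvd s * s" using p_dvd_mult by auto
  then show False using s ndvd by (simp add: cong_dvd_iff)
qed

text \<open>
  A root of a monic polynomial with coefficients integral at both places above \<open>p\<close> is integral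
  at both of them; the two places are needed because one of them alone does not control the
  denominator with respect to the basis \<open>1, w\<close>.
\<close>

lemma quartic_root_red:
  assumes z: "z \<in> F" and root: "z ^ 4 + (c3 * z ^ 3 + c2 * z\<^sup>2 + c1 * z + c0) = 0"
    and c: "red c3 r3" "red c2 r2" "red c1 r1" "red c0 r0"
    and c': "place.red D p (- s) c3 r3'" "place.red D p (- s) c2 r2'" "place.red D p (- s) c1 r1'" "place.red D p (- s) c0 r0'"
  shows "\<exists>r. red z r"
proof (rule integral_if_red[OF z])
  interpret conj: place D p "- s" by (rule place_conj)
  fix u v n assume n: "p dvd n" "of_int n * z = of_int u + of_int v * w"
  define y where "y = of_int u + of_int v * w"
  have y: "y = of_int n * z" using n(2) by (simp add: y_def)
  have "y ^ 4 + of_int n * (c3 * y ^ 3 + of_int n * c2 * y\<^sup>2 + of_int n ^ 2 * c1 * y + of_int n ^ 3 * c0) =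
      of_int n ^ 4 * (z ^ 4 + (c3 * z ^ 3 + c2 * z\<^sup>2 + c1 * z + c0))"
    unfolding y by (simp add: power_mult_distrib power4_eq_xxxx power3_eq_cube power2_eq_square algebra_simps)
  then have eq: "y ^ 4 + of_int n * (c3 * y ^ 3 + of_int n * c2 * y\<^sup>2 + of_int n ^ 2 * c1 * y + of_int n ^ 3 * c0) = 0"
    using root by simp
  have rn: "red (of_int n) n" "conj.red (of_int n) n" using red_int[of n 0] conj.red_int[of n 0] by simp_all
  have ry: "red y (u + v * s)" "conj.red y (u + v * - s)"
    unfolding y_def by (rule red_int, rule conj.red_int)
  let ?r = "u + v * s" and ?r' = "u + v * - s"
  have "red 0 (?r ^ 4 + n * (r3 * ?r ^ 3 + n * r2 * ?r\<^sup>2 + n ^ 2 * r1 * ?r + n ^ 3 * r0))"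
    unfolding eq[symmetric] by (intro red_add red_mult red_power rn ry c)
  then have 1: "p dvd ?r ^ 4" using red_0 n(1) by (meson dvd_add_left_iff dvd_mult2)
  have "conj.red 0 (?r' ^ 4 + n * (r3' * ?r' ^ 3 + n * r2' * ?r'\<^sup>2 + n ^ 2 * r1' * ?r' + n ^ 3 * r0'))"
    unfolding eq[symmetric] by (intro conj.red_add conj.red_mult conj.red_power rn ry c')
  then have 2: "p dvd ?r' ^ 4" using conj.red_0 n(1) by (meson dvd_add_left_iff dvd_mult2)
  have 3: "p dvd ?r" "p dvd ?r'" using 1 2 prime prime_dvd_power by blast+
  have "p dvd ?r - ?r'" using 3 by (rule dvd_diff)
  moreover have "?r - ?r' = (2 * s) * v" by simp
  ultimately have v: "p dvd v" using place_neg_s p_dvd_mult by metis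
  then have "p dvd u" using 3(1) by (simp add: dvd_add_left_iff)
  with v show "p dvd u \<and> p dvd v" by simp
qed

end

lemma (in quadratic) int_mk: "of_int u + of_int v * w = mk (of_int u) (of_int v)"
  by (simp add: mk_def)

section \<open>Residue symbols of the descent map\<close>

locale descent = quadratic D + curve_over a b c "quadratic.F D" for D a b c
begin

text \<open>Multiplication by N^2 clears the denominator without changing the square class, and the
  result U + V w reduces to U + V s. This is a nonzero square for i different from k and a
  nonresidue for k, so \<open>square_classes e S\<close> contains every generator except
  \<open>g k\<close> and serves as the subgroup in \<open>even_if_square\<close>.\<close>

lemma even_exponent:
  fixes N U V r :: "nat \<Rightarrow> int"
  assumes pl: "place D p s" and root: "e ^ 3 + a * e\<^sup>2 + b * e + c = 0" and e: "e \<in> F"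
    and g: "\<And>i. i < m \<Longrightarrow> g i \<in> carrier MW" and k: "k < m"
    and d: "\<And>i. i < m \<Longrightarrow> N i \<noteq> 0 \<and> of_int (N i) ^ 2 * kummer e (g i) = of_int (U i) + of_int (V i) * w"
    and r: "\<And>i. i < m \<Longrightarrow> i \<noteq> k \<Longrightarrow> \<not> p dvd r i \<and> [U i + V i * s = (r i)\<^sup>2] (mod p)"
    and nr: "\<And>t. \<not> [U k + V k * s = t\<^sup>2] (mod p)"
    and sq: "comm_group.combination MW m g n \<in> monoid.squares MW"
  shows "even (n k)"
proof -
  interpret place D p s by (rule pl)
  let ?y = "\<lambda>i. of_int (U i) + of_int (V i) * w"
  have kum: "kummer e (g i) = (inverse (of_int (N i)))\<^sup>2 * ?y i" if "i < m" for i
    using d[OF that] by (simp add: field_simps)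
  have yF: "?y i \<in> F" for i unfolding int_mk by (rule mk_in_F)
  have NF: "inverse (of_int (N i)) \<in> F" for i unfolding of_int_mk by (intro F_closed mk_in_F)
  have "g i \<in> square_classes e S \<longleftrightarrow> i \<noteq> k" if i: "i < m" for i
  proof
    assume "g i \<in> square_classes e S"
    then obtain z y where z: "z \<in> F" "y \<in> S" "z \<noteq> 0" "kummer e (g i) = z\<^sup>2 * y"
      unfolding square_classes_def[OF root e] by blast
    show "i \<noteq> k"
    proof
      assume "i = k"
      have "(inverse (of_int (N k)))\<^sup>2 * ?y k = z\<^sup>2 * y" using kum[OF i] z(4) \<open>i = k\<close> by simp
      from not_in_S[OF yF z(1) z(3) NF red_int nr this] z(2) show False by simp
    qed
  next
    assume ik: "i \<noteq> k"
    have "?y i \<in> S" unfolding S_def using red_int_coeff r[OF i ik] by blast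
    moreover have "inverse (of_int (N i)) \<noteq> (0 :: complex)" using d[OF i] by simp
    ultimately show "g i \<in> square_classes e S"
      unfolding square_classes_def[OF root e] using kum[OF i] g[OF i] NF by blast
  qed
  then show ?thesis
    using comm_group.even_if_square[OF comm_group_MW g subgroup_square_classes(1)[OF root e S_one S_mult]
      subgroup_square_classes(2)[OF root e S_one S_mult] _ sq k] by blast
qed

end

section \<open>Certificates for torsion and independence\<close>

lemma (in group) order_dvd_if_pow_eq_one:
  assumes t: "t \<in> carrier G" "t [^] (n::nat) = \<one>" "n > 0"
    and q: "\<And>q. prime q \<Longrightarrow> q dvd n \<Longrightarrow> t [^] (n div q) \<noteq> \<one>" and x: "t [^] (x::int) = \<one>"
  shows "int n dvd x"
proof -
  have "ord t dvd n" using t pow_eq_id by simp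
  then obtain m where m: "n = ord t * m" by (elim dvdE)
  have "m = 1"
  proof (rule ccontr)
    assume "m \<noteq> 1"
    then obtain q where q': "prime q" "q dvd m" using prime_factor_nat by blast
    then obtain j where j: "m = q * j" by (elim dvdE)
    have "n div q = ord t * j" using m j q'(1) by (simp add: prime_gt_0_nat)
    then have "t [^] (n div q) = \<one>" using t pow_eq_id by simp
    moreover have "q dvd n" using m j by simp
    ultimately show False using q q'(1) by blast
  qed
  then show ?thesis using m x t int_pow_eq_id by simp
qed

text \<open>Counting: two distinct elements of order 2 already generate four elements, and four is
  the bound on the 2-torsion.\<close>

lemma (in comm_group) two_torsion_generated:
  assumes s: "s \<in> carrier G" "s \<otimes> s = \<one>" "s \<noteq> \<one>" and h: "h \<in> carrier G" "h \<otimes> h = \<one>" "h \<noteq> \<one>" and "s \<noteq> h"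
    and W: "{x \<in> carrier G. x \<otimes> x = \<one>} \<subseteq> W" "finite W" "card W \<le> 4" and x: "x \<in> carrier G" "x \<otimes> x = \<one>"
  shows "x \<in> {\<one>, s, h, s \<otimes> h}"
proof -
  let ?A = "{\<one>, s, h, s \<otimes> h}"
  have sh: "s \<otimes> h \<noteq> \<one>" "s \<otimes> h \<noteq> s" "s \<otimes> h \<noteq> h"
  proof -
    show "s \<otimes> h \<noteq> \<one>"
    proof
      assume "s \<otimes> h = \<one>"
      then have "s \<otimes> h = s \<otimes> s" using s(2) by (simp only:)
      then have "h = s" using l_cancel[of s h s] s(1) h(1) by blast
      then show False using \<open>s \<noteq> h\<close> by blast
    qed
  qed (use s h in auto)
  have "card ?A = 4" using s h sh \<open>s \<noteq> h\<close> by auto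
  moreover have "?A \<subseteq> W"
  proof -
    have "(s \<otimes> h) \<otimes> (s \<otimes> h) = (s \<otimes> s) \<otimes> (h \<otimes> h)" using s h by (simp add: m_ac)
    then have "?A \<subseteq> {x \<in> carrier G. x \<otimes> x = \<one>}" using s h by auto
    then show ?thesis using W(1) by blast
  qed
  ultimately have "?A = W" using W(3) card_seteq[OF W(2), of ?A] by simp
  then show ?thesis using W(1) x by blast
qed

context curve_over begin

text \<open>The tangent slope \<open>l\<close> is supplied as a certificate, so a doubling is
  checked without division.\<close>

lemma double_eq:
  assumes "y \<noteq> 0" "l * (2 * y) = 3 * x\<^sup>2 + 2 * a * x + b" "x3 = l\<^sup>2 - a - x - x" "y3 = - (y + l * (x3 - x))"
  shows "Affine x y \<otimes>\<^bsub>MW\<^esub> Affine x y = Affine x3 y3"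
  unfolding mult_MW using add_tangent[OF assms(1-3)] assms(4) by simp

text \<open>This refutes candidate orders: if an odd or composite multiple of t vanished, two known
  multiples of t would be opposite and share their abscissa.\<close>

lemma mult_eq_one_imp_same_x:
  assumes "Affine x1 y1 \<otimes>\<^bsub>MW\<^esub> Affine x2 y2 = \<one>\<^bsub>MW\<^esub>"
  shows "x1 = x2"
  using assms by (auto simp: mult_MW one_MW point_add.simps(3) Let_def split: if_splits)

lemma opposite_eq_one: "Affine x y \<otimes>\<^bsub>MW\<^esub> Affine x (- y) = \<one>\<^bsub>MW\<^esub>"
  by (simp add: mult_MW one_MW add_opposite)

lemma doublings:
  assumes t: "t \<in> carrier MW" and 2: "t \<otimes>\<^bsub>MW\<^esub> t = t2" and 4: "t2 \<otimes>\<^bsub>MW\<^esub> t2 = t4" and 8: "t4 \<otimes>\<^bsub>MW\<^esub> t4 = t8"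
    and 16: "t8 \<otimes>\<^bsub>MW\<^esub> t8 = t16"
  shows "t [^]\<^bsub>MW\<^esub> (2::nat) = t2" "t [^]\<^bsub>MW\<^esub> (4::nat) = t4" "t [^]\<^bsub>MW\<^esub> (8::nat) = t8" "t [^]\<^bsub>MW\<^esub> (16::nat) = t16"
proof -
  interpret comm_group MW by (rule comm_group_MW)
  have d: "t [^]\<^bsub>MW\<^esub> (n + n) = t [^]\<^bsub>MW\<^esub> n \<otimes>\<^bsub>MW\<^esub> t [^]\<^bsub>MW\<^esub> n" for n :: nat using t by (simp add: nat_pow_mult)
  show t2: "t [^]\<^bsub>MW\<^esub> (2::nat) = t2" using d[of 1] t 2 by (simp only: one_add_one nat_pow_eone)
  show t4: "t [^]\<^bsub>MW\<^esub> (4::nat) = t4" using d[of 2] t2 4 by simp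
  show t8: "t [^]\<^bsub>MW\<^esub> (8::nat) = t8" using d[of 4] t4 8 by simp
  show "t [^]\<^bsub>MW\<^esub> (16::nat) = t16" using d[of 8] t8 16 by simp
qed

end

lemma prime_dvd_15: "prime q \<Longrightarrow> q dvd 15 \<Longrightarrow> q = 3 \<or> q = (5::nat)"
proof -
  assume q: "prime q" "q dvd 15"
  then have "q dvd 3 * 5" by simp
  then have "q dvd 3 \<or> q dvd 5" using q(1) prime_dvd_mult_iff by blast
  then show ?thesis using q(1) by (auto simp: primes_dvd_imp_eq)
qed

lemma prime_dvd_18: "prime q \<Longrightarrow> q dvd 18 \<Longrightarrow> q = 2 \<or> q = (3::nat)"
proof -
  assume q: "prime q" "q dvd 18"
  then have "q dvd 2 * (3 * 3)" by simp
  then have "q dvd 2 \<or> q dvd 3" using q(1) prime_dvd_mult_iff by blast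
  then show ?thesis using q(1) by (auto simp: primes_dvd_imp_eq)
qed

lemma prime_dvd_12: "prime q \<Longrightarrow> q dvd 12 \<Longrightarrow> q = 2 \<or> q = (3::nat)"
proof -
  assume q: "prime q" "q dvd 12"
  then have "q dvd 2 * (2 * 3)" by simp
  then have "q dvd 2 \<or> q dvd 3" using q(1) prime_dvd_mult_iff by blast
  then show ?thesis using q(1) by (auto simp: primes_dvd_imp_eq)
qed

lemma prime_dvd_10: "prime q \<Longrightarrow> q dvd 10 \<Longrightarrow> q = 2 \<or> q = (5::nat)"
proof -
  assume q: "prime q" "q dvd 10"
  then have "q dvd 2 * 5" by simp
  then have "q dvd 2 \<or> q dvd 5" using q(1) prime_dvd_mult_iff by blast
  then show ?thesis using q(1) by (auto simp: primes_dvd_imp_eq)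
qed

context descent begin

context
  fixes p s a0 a1 b0 b1 c0 c1 ra rb rc :: int
  assumes pl: "place D p s"
    and abc: "a = of_int a0 + of_int a1 * w" "b = of_int b0 + of_int b1 * w" "c = of_int c0 + of_int c1 * w"
    and r: "[a0 + a1 * s = ra] (mod p)" "[b0 + b1 * s = rb] (mod p)" "[c0 + c1 * s = rc] (mod p)"
begin

text \<open>A half of the point would give a root in \<open>F\<close> of the monic halving quartic.
  Its coefficients are integral at both primes above p, so the root is integral and reduces to a
  root modulo p, where the finite search finds none.\<close>

lemma not_square_if_no_root:
  assumes x: "x' = of_int x0 + of_int x1 * w" "[x0 + x1 * s = rx] (mod p)"
    and no_root: "list_all (\<lambda>r. \<not> p dvd r ^ 4 - 2 * rb * r\<^sup>2 - 8 * rc * r + rb\<^sup>2 - 4 * ra * rc - 4 * rx * (r ^ 3 + ra * r\<^sup>2 + rb * r + rc)) [0..p - 1]"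
  shows "Affine x' y' \<notin> monoid.squares MW"
proof
  interpret pl: place D p s by (rule pl)
  interpret cpl: place D p "- s" by (rule pl.place_conj)
  interpret comm_group MW by (rule comm_group_MW)
  assume "Affine x' y' \<in> monoid.squares MW"
  then obtain R where R: "R \<in> carrier MW" "Affine x' y' = point_add E R R" by (auto simp: squares_def mult_MW)
  then obtain x y where xy: "R = Affine x y" by (cases R) auto
  have on: "on_curve E (Affine x y)" and xF: "x \<in> F" using R(1) xy by (auto simp: carrier_MW)
  note q = double_x[OF on R(2)[unfolded xy, symmetric]]
  have red: "pl.red a ra" "pl.red b rb" "pl.red c rc" "pl.red x' rx"
    using abc x r pl.red_int_coeff by auto
  have red': "cpl.red a (a0 + a1 * - s)" "cpl.red b (b0 + b1 * - s)" "cpl.red c (c0 + c1 * - s)" "cpl.red x' (x0 + x1 * - s)"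
    using abc x cpl.red_int by auto
  have z: "pl.red 0 0" "cpl.red 0 0" using pl.red_int[of 0 0] cpl.red_int[of 0 0] by simp_all
  let ?a = "a0 + a1 * - s" and ?b = "b0 + b1 * - s" and ?c = "c0 + c1 * - s" and ?x = "x0 + x1 * - s"
  have q': "x ^ 4 + ((0 - 4 * x') * x ^ 3 + (0 - 2 * b - 4 * x' * a) * x\<^sup>2 + (0 - 8 * c - 4 * x' * b) * x +
        (b\<^sup>2 - 4 * a * c - 4 * x' * c)) = 0"
    using q by (simp add: algebra_simps)
  have co: "pl.red (0 - 4 * x') (0 - 4 * rx)" "pl.red (0 - 2 * b - 4 * x' * a) (0 - 2 * rb - 4 * rx * ra)"
    "pl.red (0 - 8 * c - 4 * x' * b) (0 - 8 * rc - 4 * rx * rb)"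
    "pl.red (b\<^sup>2 - 4 * a * c - 4 * x' * c) (rb\<^sup>2 - 4 * ra * rc - 4 * rx * rc)"
    by (intro pl.red_diff pl.red_mult pl.red_power pl.red_numeral red z)+
  have co': "cpl.red (0 - 4 * x') (0 - 4 * ?x)" "cpl.red (0 - 2 * b - 4 * x' * a) (0 - 2 * ?b - 4 * ?x * ?a)"
    "cpl.red (0 - 8 * c - 4 * x' * b) (0 - 8 * ?c - 4 * ?x * ?b)"
    "cpl.red (b\<^sup>2 - 4 * a * c - 4 * x' * c) (?b\<^sup>2 - 4 * ?a * ?c - 4 * ?x * ?c)"
    by (intro cpl.red_diff cpl.red_mult cpl.red_power cpl.red_numeral red' z)+
  have "\<exists>r. pl.red x r" by (rule pl.quartic_root_red[OF xF q' co co'])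
  then obtain r where "pl.red x r" ..
  then have rx: "pl.red x (r mod p)" by (rule pl.red_cong) (simp add: cong_def)
  have "pl.red 0 ((r mod p) ^ 4 - 2 * rb * (r mod p)\<^sup>2 - 8 * rc * (r mod p) + rb\<^sup>2 - 4 * ra * rc -
      4 * rx * ((r mod p) ^ 3 + ra * (r mod p)\<^sup>2 + rb * (r mod p) + rc))"
    unfolding q[symmetric] by (intro pl.red_diff pl.red_add pl.red_mult pl.red_power pl.red_numeral red rx)
  moreover have "r mod p \<in> set [0..p - 1]" using prime_gt_0_int[OF pl.prime] by simp
  ultimately show False using no_root pl.red_0 unfolding list_all_iff by blast
qed

lemma no_root_if_no_root:
  assumes no_root: "list_all (\<lambda>r. \<not> p dvd r ^ 3 + ra * r\<^sup>2 + rb * r + rc) [0..p - 1]" and x: "x \<in> F"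
  shows "x ^ 3 + a * x\<^sup>2 + b * x + c \<noteq> 0"
proof
  interpret pl: place D p s by (rule pl)
  interpret cpl: place D p "- s" by (rule pl.place_conj)
  assume f: "x ^ 3 + a * x\<^sup>2 + b * x + c = 0"
  have red: "pl.red a ra" "pl.red b rb" "pl.red c rc"
    using abc r pl.red_int_coeff by auto
  have red': "cpl.red a (a0 + a1 * - s)" "cpl.red b (b0 + b1 * - s)" "cpl.red c (c0 + c1 * - s)"
    using abc cpl.red_int by auto
  \<comment> \<open>The factor x turns the cubic into a monic quartic, to which
    \<open>quartic_root_red\<close> applies.\<close>
  have "x * (x ^ 3 + a * x\<^sup>2 + b * x + c) = 0" using f by simp
  then have "x ^ 4 + (a * x ^ 3 + b * x\<^sup>2 + c * x + 0) = 0"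
    by (simp add: algebra_simps power2_eq_square power3_eq_cube power4_eq_xxxx)
  from pl.quartic_root_red[OF x this red pl.red_int[of 0 0, simplified] red' cpl.red_int[of 0 0, simplified]]
  obtain r where "pl.red x r" ..
  then have rx: "pl.red x (r mod p)" by (rule pl.red_cong) (simp add: cong_def)
  have "pl.red 0 ((r mod p) ^ 3 + ra * (r mod p)\<^sup>2 + rb * (r mod p) + rc)"
    unfolding f[symmetric] by (intro pl.red_add pl.red_mult pl.red_power red rx)
  moreover have "r mod p \<in> set [0..p - 1]" using prime_gt_0_int[OF pl.prime] by simp
  ultimately show False using no_root pl.red_0 unfolding list_all_iff by blast
qed

lemma no_quadratic_root_if_no_root:
  assumes no_root: "list_all (\<lambda>r. \<not> p dvd r\<^sup>2 + ra * r + rb) [0..p - 1]" and x: "x \<in> F"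
  shows "x\<^sup>2 + a * x + b \<noteq> 0"
proof
  interpret pl: place D p s by (rule pl)
  interpret cpl: place D p "- s" by (rule pl.place_conj)
  assume f: "x\<^sup>2 + a * x + b = 0"
  have red: "pl.red a ra" "pl.red b rb"
    using abc r pl.red_int_coeff by auto
  have red': "cpl.red a (a0 + a1 * - s)" "cpl.red b (b0 + b1 * - s)"
    using abc cpl.red_int by auto
  have z: "pl.red 0 0" "cpl.red 0 0" using pl.red_int[of 0 0] cpl.red_int[of 0 0] by simp_all
  have "x\<^sup>2 * (x\<^sup>2 + a * x + b) = 0" using f by simp
  then have "x ^ 4 + (a * x ^ 3 + b * x\<^sup>2 + 0 * x + 0) = 0"
    by (simp add: algebra_simps power2_eq_square power3_eq_cube power4_eq_xxxx)
  from pl.quartic_root_red[OF x this red z(1) z(1) red' z(2) z(2)]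
  obtain r where "pl.red x r" ..
  then have rx: "pl.red x (r mod p)" by (rule pl.red_cong) (simp add: cong_def)
  have "pl.red 0 ((r mod p)\<^sup>2 + ra * (r mod p) + rb)"
    unfolding f[symmetric] by (intro pl.red_add pl.red_mult pl.red_power red rx)
  moreover have "r mod p \<in> set [0..p - 1]" using prime_gt_0_int[OF pl.prime] by simp
  ultimately show False using no_root pl.red_0 unfolding list_all_iff by blast
qed

end

end

lemma nat_pow_split:
  fixes G (structure)
  assumes "monoid G" "t \<in> carrier G" "n = i + (j::nat)"
  shows "t [^] n = t [^] i \<otimes> t [^] j"
  using assms monoid.nat_pow_mult[of G t i j] by simp


context comm_group begin

lemma combination_single:
  assumes g: "\<And>i. i < m \<Longrightarrow> g i \<in> carrier G" and k: "k < m"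
  shows "combination m g (\<lambda>i. if i = k then x else 0) = g k [^] (x::int)"
proof -
  have "combination m g (\<lambda>i. if i = k then x else 0) = (\<Otimes>i\<in>{..<m}. if k = i then g i [^] x else \<one>)"
    unfolding combination_def using g by (intro finprod_cong') auto
  also have "\<dots> = g k [^] x" using g k by (subst finprod_singleton) auto
  finally show ?thesis .
qed

text \<open>A combination with odd exponent only at k is \<open>g k\<close> times a square; if it is
  a square, so is \<open>g k\<close>. This settles the last exponent when no character detects
  it.\<close>

lemma even_if_not_square:
  assumes g: "\<And>i. i < m \<Longrightarrow> g i \<in> carrier G" and k: "k < m" and sq: "combination m g n \<in> squares"
    and ev: "\<And>i. i < m \<Longrightarrow> i \<noteq> k \<Longrightarrow> even (n i)" and gk: "g k \<notin> squares"
  shows "even (n k)"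
proof (rule ccontr)
  assume odd: "odd (n k)"
  define j where "j i = n i div 2" for i
  let ?d = "\<lambda>i. if i = k then 1 else 0 :: int"
  have n: "n i = ?d i + (j i + j i)" if "i < m" for i
    using ev[OF that] odd by (cases "i = k") (auto simp: j_def elim!: evenE oddE)
  have J: "combination m g j \<in> carrier G" (is "?J \<in> _") using g by (rule combination_closed)
  have "combination m g n = combination m g (\<lambda>i. ?d i + (j i + j i))" using g n by (intro combination_cong) auto
  also have "\<dots> = combination m g ?d \<otimes> combination m g (\<lambda>i. j i + j i)" using g by (intro combination_add)
  also have "combination m g (\<lambda>i. j i + j i) = ?J \<otimes> ?J" using g by (intro combination_add)
  also have "combination m g ?d = g k" using g k by (subst combination_single) auto
  finally have eq: "combination m g n = g k \<otimes> (?J \<otimes> ?J)" .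
  obtain q where q: "q \<in> carrier G" "combination m g n = q \<otimes> q" using sq by (auto simp: squares_def)
  have gk': "g k \<in> carrier G" using g k by blast
  have JJ: "(?J \<otimes> ?J) \<otimes> (inv ?J \<otimes> inv ?J) = \<one>" unfolding inv_mult[OF J J, symmetric] using J by simp
  have "(q \<otimes> inv ?J) \<otimes> (q \<otimes> inv ?J) = (q \<otimes> q) \<otimes> (inv ?J \<otimes> inv ?J)" using q(1) J by (simp add: m_ac)
  also have "\<dots> = (g k \<otimes> (?J \<otimes> ?J)) \<otimes> (inv ?J \<otimes> inv ?J)" using eq q(2) by simp
  also have "\<dots> = g k \<otimes> ((?J \<otimes> ?J) \<otimes> (inv ?J \<otimes> inv ?J))" by (rule m_assoc) (use gk' J in auto)
  also have "\<dots> = g k" unfolding JJ using gk' by simp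
  finally have "g k = (q \<otimes> inv ?J) \<otimes> (q \<otimes> inv ?J)" by simp
  moreover have "q \<otimes> inv ?J \<in> carrier G" using q(1) J by simp
  ultimately show False using gk unfolding squares_def by blast
qed

end

text \<open>The residue symbol at the place is -1 on entry k and +1 on all others. The search for a
  root starts at 1 to exclude residue 0, while the nonresidue test includes 0. Both are
  executable.\<close>

definition character :: "int \<Rightarrow> int \<Rightarrow> nat \<Rightarrow> (int \<times> int \<times> int) list \<Rightarrow> bool" where
  "character p s k ds \<longleftrightarrow> list_all (\<lambda>i. case ds ! i of (N, U, V) \<Rightarrow>
     let u = (U + V * s) mod p
     in if i = k then list_all (\<lambda>t. t * t mod p \<noteq> u) [0..p - 1] else list_ex (\<lambda>t. t * t mod p = u) [1..p - 1])
   [0..<length ds]"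

context descent begin

text \<open>A certificate for the descent map: each triple gives its value as (U + V w)/N^2. The
  identity is phrased through \<open>mk\<close> so that \<open>mk_simps\<close> evaluates
  it.\<close>

definition kummer_values :: "complex \<Rightarrow> complex point list \<Rightarrow> (int \<times> int \<times> int) list \<Rightarrow> bool" where
  "kummer_values e gs ds \<longleftrightarrow> e ^ 3 + a * e\<^sup>2 + b * e + c = 0 \<and> e \<in> F \<and>
     list_all2 (\<lambda>P (N, U, V). N \<noteq> 0 \<and> mk (of_int N) 0 * mk (of_int N) 0 * kummer e P = mk (of_int U) (of_int V)) gs ds"

lemma even_exponent_if_character:
  assumes pl: "place D p s" and v: "kummer_values e gs ds" and ch: "character p s k ds"
    and g: "set gs \<subseteq> carrier MW" and k: "k < length gs"
    and sq: "comm_group.combination MW (length gs) ((!) gs) n \<in> monoid.squares MW"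
  shows "even (n k)"
proof -
  interpret place D p s by (rule pl)
  define N U V where "N i = fst (ds ! i)" and "U i = fst (snd (ds ! i))" and "V i = snd (snd (ds ! i))" for i
  have len: "length ds = length gs" using v unfolding kummer_values_def by (auto dest: list_all2_lengthD)
  have p0: "p > 0" using prime prime_gt_0_int by blast
  have ds: "ds ! i = (N i, U i, V i)" for i by (simp add: N_def U_def V_def)
  have ch': "if i = k then list_all (\<lambda>t. t * t mod p \<noteq> (U i + V i * s) mod p) [0..p - 1]
      else list_ex (\<lambda>t. t * t mod p = (U i + V i * s) mod p) [1..p - 1]" if "i < length gs" for i
  proof -
    have "i \<in> set [0..<length ds]" using that len by simp
    from bspec[OF iffD1[OF list_all_iff ch[unfolded character_def]] this]
    show ?thesis unfolding ds prod.case Let_def .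
  qed
  have "\<exists>r. \<not> p dvd r \<and> [U i + V i * s = r\<^sup>2] (mod p)" if i: "i < length gs" "i \<noteq> k" for i
  proof -
    have "list_ex (\<lambda>t. t * t mod p = (U i + V i * s) mod p) [1..p - 1]"
      using ch'[OF i(1)] i(2) by (simp only: if_False)
    then obtain t where "t \<in> set [1..p - 1]" and t3: "t * t mod p = (U i + V i * s) mod p"
      unfolding list_ex_iff by blast
    then have t: "1 \<le> t" "t < p" by auto
    then have "\<not> p dvd t" by (simp add: zdvd_not_zless)
    moreover have "[U i + V i * s = t\<^sup>2] (mod p)" using t3 by (simp add: cong_def power2_eq_square)
    ultimately show ?thesis by blast
  qed
  note ex = this
  define r where "r i = (SOME r. \<not> p dvd r \<and> [U i + V i * s = r\<^sup>2] (mod p))" for i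
  have r: "\<not> p dvd r i \<and> [U i + V i * s = (r i)\<^sup>2] (mod p)" if "i < length gs" "i \<noteq> k" for i
    unfolding r_def by (rule someI_ex[OF ex[OF that]])
  have nr: "\<not> [U k + V k * s = t\<^sup>2] (mod p)" for t
  proof
    assume "[U k + V k * s = t\<^sup>2] (mod p)"
    then have eq: "(t mod p) * (t mod p) mod p = (U k + V k * s) mod p"
      by (simp add: cong_def power2_eq_square mod_mult_eq)
    have mem: "t mod p \<in> set [0..p - 1]" using p0 by simp
    have L: "list_all (\<lambda>t. t * t mod p \<noteq> (U k + V k * s) mod p) [0..p - 1]"
      using ch'[OF k] by (simp only: refl if_True)
    have "(t mod p) * (t mod p) mod p \<noteq> (U k + V k * s) mod p"
      by (rule bspec[OF iffD1[OF list_all_iff L] mem])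
    then show False using eq by (rule notE)
  qed
  show ?thesis
  proof (rule even_exponent[where g = "(!) gs" and m = "length gs" and N = N and U = U and V = V and r = r and e = e, OF pl _ _ _ k _ r nr sq])
    fix i assume i: "i < length gs"
    then show "gs ! i \<in> carrier MW" using g by auto
    have "list_all2 (\<lambda>P (N, U, V). N \<noteq> 0 \<and> mk (of_int N) 0 * mk (of_int N) 0 * kummer e P = mk (of_int U) (of_int V)) gs ds"
      using v unfolding kummer_values_def by blast
    from list_all2_nthD[OF this i]
    have "N i \<noteq> 0 \<and> mk (of_int (N i)) 0 * mk (of_int (N i)) 0 * kummer e (gs ! i) = mk (of_int (U i)) (of_int (V i))"
      by (simp add: ds)
    then show "N i \<noteq> 0 \<and> of_int (N i) ^ 2 * kummer e (gs ! i) = of_int (U i) + of_int (V i) * w"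
      unfolding int_mk unfolding of_int_mk power2_eq_square .
  next
    show "e ^ 3 + a * e\<^sup>2 + b * e + c = 0" "e \<in> F" using v unfolding kummer_values_def by blast+
  qed
qed

lemma elliptic_curve_over_F: "elliptic_curve_over F E"
  using K_coeffs K_zero disc by (simp add: elliptic_curve_over_def)

text \<open>With all three roots in the field, the 2-torsion is the point at infinity and the three
  points (e, 0). It is generated by \<open>gs ! 0\<close> and the multiple of \<open>gs ! 1\<close>
  of order 2, once these are known to differ.\<close>

lemma has_subgroup_if_full_two_torsion:
  assumes gs: "set gs \<subseteq> carrier MW" "length gs = Suc (Suc r)" "gs ! 0 = Affine e1 0"
    and roots: "a = - (e1 + e2 + e3)" "b = e1 * e2 + e1 * e3 + e2 * e3" "c = - (e1 * e2 * e3)"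
    and ev: "\<And>n k. comm_group.combination MW (length gs) ((!) gs) n \<in> monoid.squares MW \<Longrightarrow> k < length gs \<Longrightarrow> even (n k)"
    and t: "gs ! 1 [^]\<^bsub>MW\<^esub> (2 * m) = \<one>\<^bsub>MW\<^esub>" "\<And>q. prime q \<Longrightarrow> q dvd 2 * m \<Longrightarrow> gs ! 1 [^]\<^bsub>MW\<^esub> (2 * m div q) \<noteq> \<one>\<^bsub>MW\<^esub>"
    and m: "m > (0::nat)"
  shows "has_subgroup_isomorphic_to MW (integer_mod_group 2 \<times>\<times> integer_mod_group (2 * m) \<times>\<times> free_abelian_group_of_rank r)"
proof -
  interpret G: comm_group MW by (rule comm_group_MW)
  let ?s = "gs ! 0" and ?t = "gs ! 1"
  have g: "gs ! i \<in> carrier MW" if "i < length gs" for i using gs(1) that by auto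
  have st: "?s \<in> carrier MW" "?t \<in> carrier MW" using g gs(2) by auto
  have s: "?s \<otimes>\<^bsub>MW\<^esub> ?s = \<one>\<^bsub>MW\<^esub>" "?s \<noteq> \<one>\<^bsub>MW\<^esub>"
    using opposite_eq_one[of e1 0] by (simp_all add: gs(3) one_MW)
  define h where "h = ?t [^]\<^bsub>MW\<^esub> m"
  have h: "h \<in> carrier MW" "h \<otimes>\<^bsub>MW\<^esub> h = \<one>\<^bsub>MW\<^esub>" "h \<noteq> \<one>\<^bsub>MW\<^esub>"
    using st t(1) t(2)[of 2] by (simp_all add: h_def G.nat_pow_mult mult_2[symmetric])
  have "?s \<noteq> h"
  \<comment> \<open>If they coincided, their sum would be trivial, hence a square, although its
    exponent at \<open>gs ! 0\<close> is 1.\<close>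
  proof
    assume sh: "?s = h"
    let ?d = "\<lambda>i::nat. if i = 0 then 1 else 0 :: int" and ?e = "\<lambda>i::nat. if i = 1 then int m else 0"
    have "G.combination (length gs) ((!) gs) (\<lambda>i. ?d i + ?e i) = ?s [^]\<^bsub>MW\<^esub> (1::int) \<otimes>\<^bsub>MW\<^esub> ?t [^]\<^bsub>MW\<^esub> int m"
      using g gs(2) by (simp add: G.combination_add G.combination_single)
    also have "\<dots> = ?s \<otimes>\<^bsub>MW\<^esub> h" using st by (simp add: h_def int_pow_int)
    also have "\<dots> = \<one>\<^bsub>MW\<^esub>" using h(2) sh by simp
    also have "\<dots> \<in> G.squares" by (force simp: G.squares_def)
    finally show False using ev[of "\<lambda>i. ?d i + ?e i" 0] gs(2) by simp
  qed
  have tor: "x \<in> {\<one>\<^bsub>MW\<^esub>, ?s, h, ?s \<otimes>\<^bsub>MW\<^esub> h}" if x: "x \<in> carrier MW" "x \<otimes>\<^bsub>MW\<^esub> x = \<one>\<^bsub>MW\<^esub>" for x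
  proof (rule G.two_torsion_generated[OF st(1) s h \<open>?s \<noteq> h\<close> _ _ _ x])
    let ?W = "set [Infinity, Affine e1 0, Affine e2 0, Affine e3 0]"
    show "{x \<in> carrier MW. x \<otimes>\<^bsub>MW\<^esub> x = \<one>\<^bsub>MW\<^esub>} \<subseteq> ?W"
    proof
      fix z assume z: "z \<in> {x \<in> carrier MW. x \<otimes>\<^bsub>MW\<^esub> x = \<one>\<^bsub>MW\<^esub>}"
      show "z \<in> ?W"
      proof (cases "z = Infinity")
        case False
        then obtain x where x: "z = Affine x 0" "x ^ 3 + a * x\<^sup>2 + b * x + c = 0" using two_torsion z by blast
        have "(x - e1) * (x - e2) * (x - e3) = 0"
          using x(2) unfolding roots by (simp add: algebra_simps power2_eq_square power3_eq_cube)
        then show ?thesis using x(1) by auto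
      qed simp
    qed
    show "card ?W \<le> 4" using card_length[of "[Infinity, Affine e1 0, Affine e2 0, Affine e3 0]"] by simp
  qed simp
  show ?thesis
  proof (rule G.has_subgroup_two_cyclic_times_free[where g = "(!) gs"])
    fix x assume "x \<in> carrier MW" "x \<otimes>\<^bsub>MW\<^esub> x = \<one>\<^bsub>MW\<^esub>"
    then have "x \<in> {\<one>\<^bsub>MW\<^esub>, ?s, h, ?s \<otimes>\<^bsub>MW\<^esub> h}" by (rule tor)
    moreover have "\<one>\<^bsub>MW\<^esub> = ?s [^]\<^bsub>MW\<^esub> (0::int) \<otimes>\<^bsub>MW\<^esub> ?t [^]\<^bsub>MW\<^esub> (0::int)"
      "?s = ?s [^]\<^bsub>MW\<^esub> (1::int) \<otimes>\<^bsub>MW\<^esub> ?t [^]\<^bsub>MW\<^esub> (0::int)" "h = ?s [^]\<^bsub>MW\<^esub> (0::int) \<otimes>\<^bsub>MW\<^esub> ?t [^]\<^bsub>MW\<^esub> (int m)"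
      "?s \<otimes>\<^bsub>MW\<^esub> h = ?s [^]\<^bsub>MW\<^esub> (1::int) \<otimes>\<^bsub>MW\<^esub> ?t [^]\<^bsub>MW\<^esub> (int m)"
      using st h(1) by (simp_all add: int_pow_int h_def)
    ultimately show "\<exists>(c::int) (d::int). x = ?s [^]\<^bsub>MW\<^esub> c \<otimes>\<^bsub>MW\<^esub> ?t [^]\<^bsub>MW\<^esub> d" by blast
  next
    fix x :: int assume "?t [^]\<^bsub>MW\<^esub> x = \<one>\<^bsub>MW\<^esub>"
    with m show "int (2 * m) dvd x" by (intro G.order_dvd_if_pow_eq_one[OF st(2) t(1) _ t(2)]) auto
  next
    show "gs ! i \<in> carrier MW" if "i \<le> Suc r" for i using g[of i] gs(2) that by simp
    show "even (n i)" if "G.combination (Suc (Suc r)) ((!) gs) n \<in> G.squares" "i \<le> Suc r" for n i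
      using ev[of n i] gs(2) that by simp
    show "?s \<otimes>\<^bsub>MW\<^esub> ?s = \<one>\<^bsub>MW\<^esub>" by (rule s(1))
    show "?t [^]\<^bsub>MW\<^esub> (2 * m) = \<one>\<^bsub>MW\<^esub>" by (rule t(1))
    show "0 < 2 * m" using m by simp
  qed
qed

end

section \<open>The four curves\<close>

theorem torsion_15_rank_1:
  "\<exists>K E. quadratic_number_field K \<and> elliptic_curve_over K E \<and>
     has_subgroup_isomorphic_to (mordell_weil_group E K) (integer_mod_group 15 \<times>\<times> integer_group)"
proof -
  interpret quadratic "-7" by unfold_locales (smt (verit) zero_le_power2)
  define a b c where "a = mk 141 (-44)" and "b = mk 1232 (-3344)" and "c = mk (-72576) 11648"
  interpret descent "-7" a b c
  proof unfold_locales
    show "discriminant (Weierstrass 0 a 0 b c) \<noteq> 0"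
      by (simp add: discriminant_def Let_def a_def b_def c_def mk_simps)
  qed (auto simp: a_def b_def c_def mk_in_F intro: F_closed)
  interpret G: comm_group MW by (rule comm_group_MW)
  have abc: "a = of_int 141 + of_int (-44) * w"
    "b = of_int 1232 + of_int (-3344) * w"
    "c = of_int (-72576) + of_int 11648 * w"
    unfolding int_mk by (simp_all add: a_def b_def c_def)
  let ?t = "Affine (mk 0 0) (mk (-56) (-104))"
    and ?t2 = "Affine (mk 56 104) (mk 672 (-1568))"
    and ?t4 = "Affine (mk (-28) 36) (mk 28 (-212))"
    and ?t8 = "Affine (mk (-84) 20) (mk (-140) (-84))"
  have d2: "?t \<otimes>\<^bsub>MW\<^esub> ?t = ?t2"
    by (rule double_eq[of _ "mk 15 2"]) (simp_all add: a_def b_def c_def mk_simps)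
  have d4: "?t2 \<otimes>\<^bsub>MW\<^esub> ?t2 = ?t4"
    by (rule double_eq[of _ "mk (-20) (-5)"]) (simp_all add: a_def b_def c_def mk_simps)
  have d8: "?t4 \<otimes>\<^bsub>MW\<^esub> ?t4 = ?t8"
    by (rule double_eq[of _ "mk (-8) (-3)"]) (simp_all add: a_def b_def c_def mk_simps)
  have d16: "?t8 \<otimes>\<^bsub>MW\<^esub> ?t8 = ?t"
    by (rule double_eq[of _ "mk (-1) 2"]) (simp_all add: a_def b_def c_def mk_simps)
  let ?P = "Affine (mk (-112) 32) (mk 504 152)"
  have t: "?t \<in> carrier MW" and P: "?P \<in> carrier MW"
    unfolding carrier_MW by (simp_all add: mk_in_F a_def b_def c_def mk_simps)
  note pow = doublings[OF t d2 d4 d8 d16]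
  have tk: "?t [^]\<^bsub>MW\<^esub> (15::nat) = \<one>\<^bsub>MW\<^esub>"
  proof -
    \<comment> \<open>Four doublings return to the start: 16 t = t.\<close>
    have "?t [^]\<^bsub>MW\<^esub> (15::nat) \<otimes>\<^bsub>MW\<^esub> ?t = ?t"
      using nat_pow_split[OF G.monoid_axioms t, of 16 15 1] t unfolding pow by simp
    then show ?thesis by (metis G.nat_pow_closed G.r_cancel_one t)
  qed
  have t5: "?t [^]\<^bsub>MW\<^esub> (5::nat) \<noteq> \<one>\<^bsub>MW\<^esub>"
  proof
    assume "?t [^]\<^bsub>MW\<^esub> (5::nat) = \<one>\<^bsub>MW\<^esub>"
    then have "?t4 \<otimes>\<^bsub>MW\<^esub> ?t = \<one>\<^bsub>MW\<^esub>"
      using nat_pow_split[OF G.monoid_axioms t, of 5 4 1] t unfolding pow by simp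
    from mult_eq_one_imp_same_x[OF this] show False by (simp add: mk_eq_iff)
  qed
  have t3: "?t [^]\<^bsub>MW\<^esub> (3::nat) \<noteq> \<one>\<^bsub>MW\<^esub>"
  proof
    assume "?t [^]\<^bsub>MW\<^esub> (3::nat) = \<one>\<^bsub>MW\<^esub>"
    then have "?t4 = ?t"
      using nat_pow_split[OF G.monoid_axioms t, of 4 3 1] t unfolding pow by simp
    then show False by (simp add: mk_eq_iff)
  qed
  have pl11: "place (-7) 11 9" by unfold_locales (simp_all add: cong_def)
  have pl23: "place (-7) 23 4" by unfold_locales (simp_all add: cong_def)
  have Px: "mk (-112) 32 = of_int (-112) + of_int 32 * w" unfolding int_mk by simp
  \<comment> \<open>11, 0, 6, 16 are the residues of a, b, c and the abscissa of \<open>?P\<close>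
    modulo 23 under \<open>w\<close> -> 4.\<close>
  have nsq: "?P \<notin> G.squares"
    by (rule not_square_if_no_root[OF pl23 abc _ _ _ Px, of 11 0 6 16]) (simp_all only: cong_def, code_simp+)
  \<comment> \<open>Under \<open>w\<close> -> 9 modulo 11 the cubic is x^3 + 9 x^2 + 4, which has no
    root; hence there is no point of order 2 over the field.\<close>
  have nr: "x ^ 3 + a * x\<^sup>2 + b * x + c \<noteq> 0" if "x \<in> F" for x
    by (rule no_root_if_no_root[OF pl11 abc _ _ _ _ that, of 9 0 4]) (simp_all only: cong_def, code_simp+)
  have "has_subgroup_isomorphic_to MW (integer_mod_group 15 \<times>\<times> integer_group)"
  proof (rule G.has_subgroup_cyclic_times_Z[OF t tk _ _ P nsq])
    fix x :: int assume x: "?t [^]\<^bsub>MW\<^esub> x = \<one>\<^bsub>MW\<^esub>"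
    show "int 15 dvd x"
    proof (rule G.order_dvd_if_pow_eq_one[OF t tk _ _ x])
      fix q :: nat assume "prime q" "q dvd 15"
      then have "q = 3 \<or> q = 5" by (rule prime_dvd_15)
      then show "?t [^]\<^bsub>MW\<^esub> (15 div q) \<noteq> \<one>\<^bsub>MW\<^esub>" using t3 t5 by auto
    qed simp
  next
    fix x assume x: "x \<in> carrier MW" "x \<otimes>\<^bsub>MW\<^esub> x = \<one>\<^bsub>MW\<^esub>"
    show "x = \<one>\<^bsub>MW\<^esub>"
    proof (rule ccontr)
      assume "x \<noteq> \<one>\<^bsub>MW\<^esub>"
      then have "x \<noteq> Infinity" by (simp add: one_MW)
      then show False by (rule two_torsion[OF x]) (use nr in blast)
    qed
  qed simp
  then show ?thesis using quadratic_number_field_F elliptic_curve_over_F by blast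
qed

theorem torsion_18_rank_2:
  "\<exists>K E. quadratic_number_field K \<and> elliptic_curve_over K E \<and>
     has_subgroup_isomorphic_to (mordell_weil_group E K) (integer_mod_group 18 \<times>\<times> free_abelian_group_of_rank 2)"
proof -
  interpret quadratic "26521" by unfold_locales (rule not_square_int[of 162]; simp)
  define a b c where "a = mk (-2522790002) 19969314" and "b = mk 4168469879014423688 (-25596539667315992)" and "c = mk 0 0"
  interpret descent "26521" a b c
  proof unfold_locales
    show "discriminant (Weierstrass 0 a 0 b c) \<noteq> 0"
      by (simp add: discriminant_def Let_def a_def b_def c_def mk_simps)
  qed (auto simp: a_def b_def c_def mk_in_F intro: F_closed)
  interpret G: comm_group MW by (rule comm_group_MW)
  have abc: "a = of_int (-2522790002) + of_int 19969314 * w"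
    "b = of_int 4168469879014423688 + of_int (-25596539667315992) * w"
    "c = of_int 0 + of_int 0 * w"
    unfolding int_mk by (simp_all add: a_def b_def c_def)
  let ?t = "Affine (mk 1432571522 (-8796518)) (mk (-397485556320) 2434501920)"
    and ?t2 = "Affine (mk 3255899762 (-19963958)) (mk (-145927218542400) 896853758400)"
    and ?t4 = "Affine (mk 1695463922 (-10410998)) (mk (-14651667679680) 89970045120)"
    and ?t8 = "Affine (mk 1518473762 (-8543558)) (mk (-2263426485600) (-8947269600))"
    and ?t16 = "Affine (mk 3255899762 (-19963958)) (mk 145927218542400 (-896853758400))"
  have d2: "?t \<otimes>\<^bsub>MW\<^esub> ?t = ?t2"
    by (rule double_eq[of _ "mk 26648 (-330)"]) (simp_all add: a_def b_def c_def mk_simps)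
  have d4: "?t2 \<otimes>\<^bsub>MW\<^esub> ?t2 = ?t4"
    by (rule double_eq[of _ "mk (-37962) 400"]) (simp_all add: a_def b_def c_def mk_simps)
  have d8: "?t4 \<otimes>\<^bsub>MW\<^esub> ?t4 = ?t8"
    by (rule double_eq[of _ "mk (-16660) 282"]) (simp_all add: a_def b_def c_def mk_simps)
  have d16: "?t8 \<otimes>\<^bsub>MW\<^esub> ?t8 = ?t16"
    by (rule double_eq[of _ "mk (-56190) 152"]) (simp_all add: a_def b_def c_def mk_simps)
  define gs where "gs = [?t,
    Affine (mk 190580690 (-990806)) (mk 23379822662400 (-148507142400)),
    Affine (mk 141523202 (-2308838)) (mk 29563720345440 (-149510207520))]"
  have carrier: "set gs \<subseteq> carrier MW"
    unfolding carrier_MW gs_def by (simp add: K_zero mk_in_F a_def b_def c_def mk_simps)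
  have g: "gs ! i \<in> carrier MW" if "i < length gs" for i using carrier that by auto
  have t: "?t \<in> carrier MW" using carrier by (simp add: gs_def)
  have len: "length gs = 3" by (simp add: gs_def)
  note pow = doublings[OF t d2 d4 d8 d16]
  have tk: "?t [^]\<^bsub>MW\<^esub> (18::nat) = \<one>\<^bsub>MW\<^esub>"
  proof -
    \<comment> \<open>The fourth doubling gives 16 t = -2 t, so 18 t vanishes.\<close>
    have "?t [^]\<^bsub>MW\<^esub> (18::nat) = ?t2 \<otimes>\<^bsub>MW\<^esub> ?t16"
      using nat_pow_split[OF G.monoid_axioms t, of 18 2 16] unfolding pow by simp
    also have "\<dots> = \<one>\<^bsub>MW\<^esub>"
      using opposite_eq_one[of "mk 3255899762 (-19963958)" "mk (-145927218542400) 896853758400"] by (simp add: mk_minus)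
    finally show ?thesis .
  qed
  have t9: "?t [^]\<^bsub>MW\<^esub> (9::nat) \<noteq> \<one>\<^bsub>MW\<^esub>"
  proof
    assume "?t [^]\<^bsub>MW\<^esub> (9::nat) = \<one>\<^bsub>MW\<^esub>"
    then have "?t8 \<otimes>\<^bsub>MW\<^esub> ?t = \<one>\<^bsub>MW\<^esub>"
      using nat_pow_split[OF G.monoid_axioms t, of 9 8 1] t unfolding pow by simp
    from mult_eq_one_imp_same_x[OF this] show False by (simp add: mk_eq_iff)
  qed
  have t6: "?t [^]\<^bsub>MW\<^esub> (6::nat) \<noteq> \<one>\<^bsub>MW\<^esub>"
  proof
    assume "?t [^]\<^bsub>MW\<^esub> (6::nat) = \<one>\<^bsub>MW\<^esub>"
    then have "?t4 \<otimes>\<^bsub>MW\<^esub> ?t2 = \<one>\<^bsub>MW\<^esub>"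
      using nat_pow_split[OF G.monoid_axioms t, of 6 4 2] t unfolding pow by simp
    from mult_eq_one_imp_same_x[OF this] show False by (simp add: mk_eq_iff)
  qed
  have v: "kummer_values (mk 0 0) gs [(1, 1432571522, -8796518), (1, 190580690, -990806), (1, 141523202, -2308838)]"
    unfolding kummer_values_def gs_def kummer_def by (simp add: K_zero mk_in_F a_def b_def c_def mk_simps)
  have pl13: "place 26521 13 1" by unfold_locales (simp_all add: cong_def)
  have pl71: "place 26521 71 31" by unfold_locales (simp_all add: cong_def)
  \<comment> \<open>40 = -31 modulo 71, so this is the other prime above 71.\<close>
  have pl71': "place 26521 71 40" by unfold_locales (simp_all add: cong_def)
  have ch0: "character 13 1 0 [(1, 1432571522, -8796518), (1, 190580690, -990806), (1, 141523202, -2308838)]" by code_simp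
  have ch2: "character 71 40 2 [(1, 1432571522, -8796518), (1, 190580690, -990806), (1, 141523202, -2308838)]" by code_simp
  have Px: "mk 190580690 (-990806) = of_int 190580690 + of_int (-990806) * w" unfolding int_mk by simp
  have g1: "gs ! 1 = Affine (mk 190580690 (-990806)) (mk 23379822662400 (-148507142400))" by (simp add: gs_def)
  \<comment> \<open>The abscissa of \<open>gs ! 1\<close> is the square of
    \<open>mk 12083 (-41)\<close>, so the descent map at e = 0 is trivial on this point and no
    character can detect it. The halving quartic under \<open>w\<close> -> 31 modulo 71 is used
    instead.\<close>
  have nsq: "gs ! 1 \<notin> G.squares"
    unfolding g1
    by (rule not_square_if_no_root[OF pl71 abc _ _ _ Px, of 50 17 0 45]) (simp_all only: cong_def, code_simp+)
  \<comment> \<open>The quadratic factor reduces to x^2 + 9 x + 6 modulo 13, without roots. So (0,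
    0) is the only point of order 2 and equals 9 t.\<close>
  have nr: "x\<^sup>2 + a * x + b \<noteq> 0" if "x \<in> F" for x
    by (rule no_quadratic_root_if_no_root[OF pl13 abc _ _ _ _ that, of 9 6 0]) (simp_all only: cong_def, code_simp+)
  have tor: "x = Affine 0 0" if x: "x \<in> carrier MW" "x \<otimes>\<^bsub>MW\<^esub> x = \<one>\<^bsub>MW\<^esub>" "x \<noteq> \<one>\<^bsub>MW\<^esub>" for x
  proof -
    have "x \<noteq> Infinity" using x(3) by (simp add: one_MW)
    then obtain z where z: "x = Affine z 0" "z ^ 3 + a * z\<^sup>2 + b * z + c = 0" "z \<in> F"
      using two_torsion[OF x(1,2)] by blast
    have "c = 0" by (simp add: c_def mk_simps)
    then have "z * (z\<^sup>2 + a * z + b) = 0"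
      using z(2) by (simp add: algebra_simps power2_eq_square power3_eq_cube)
    then show ?thesis using nr[OF z(3)] z(1) by simp
  qed
  have h: "?t [^]\<^bsub>MW\<^esub> (9::nat) = Affine 0 0"
    using t tk t9 by (intro tor) (simp_all add: G.nat_pow_mult)
  have "has_subgroup_isomorphic_to MW (integer_mod_group 18 \<times>\<times> free_abelian_group_of_rank 2)"
  proof (rule G.has_subgroup_cyclic_times_free[where g = "(!) gs"])
    fix n and i :: nat assume "G.combination (Suc 2) ((!) gs) n \<in> G.squares" "i \<le> 2"
    then have sq: "G.combination (length gs) ((!) gs) n \<in> G.squares" and "i = 0 \<or> i = 1 \<or> i = 2"
      by (simp_all add: len, linarith)
    have e: "even (n 0)" "even (n 2)"
      using even_exponent_if_character[OF pl13 v ch0 carrier _ sq] even_exponent_if_character[OF pl71' v ch2 carrier _ sq]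
      by (simp_all add: len)
    moreover have "even (n 1)"
    proof (rule G.even_if_not_square[OF g _ sq _ nsq])
      fix i assume "i < length gs" "i \<noteq> 1"
      then have "i = 0 \<or> i = 2" using len by linarith
      then show "even (n i)" using e by blast
    qed (simp_all add: len)
    ultimately show "even (n i)" using \<open>i = 0 \<or> i = 1 \<or> i = 2\<close> by blast
  next
    fix x :: int assume "gs ! 0 [^]\<^bsub>MW\<^esub> x = \<one>\<^bsub>MW\<^esub>"
    then have x: "?t [^]\<^bsub>MW\<^esub> x = \<one>\<^bsub>MW\<^esub>" by (simp add: gs_def)
    show "int 18 dvd x"
    proof (rule G.order_dvd_if_pow_eq_one[OF t tk _ _ x])
      fix q :: nat assume "prime q" "q dvd 18"
      then have "q = 2 \<or> q = 3" by (rule prime_dvd_18)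
      then show "?t [^]\<^bsub>MW\<^esub> (18 div q) \<noteq> \<one>\<^bsub>MW\<^esub>" using t6 t9 by auto
    qed simp
  next
    fix x assume x: "x \<in> carrier MW" "x \<otimes>\<^bsub>MW\<^esub> x = \<one>\<^bsub>MW\<^esub>"
    show "\<exists>c::int. x = gs ! 0 [^]\<^bsub>MW\<^esub> c"
    proof (cases "x = \<one>\<^bsub>MW\<^esub>")
      case True
      then show ?thesis by (intro exI[of _ 0]) simp
    next
      case False
      then have "x = ?t [^]\<^bsub>MW\<^esub> (9::nat)" using tor[OF x] h by simp
      also have "\<dots> = gs ! 0 [^]\<^bsub>MW\<^esub> (int 9)" unfolding int_pow_int by (simp add: gs_def)
      finally show ?thesis by blast
    qed
  next
    show "gs ! i \<in> carrier MW" if "i \<le> 2" for i using g[of i] len that by simp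
    show "gs ! 0 [^]\<^bsub>MW\<^esub> (18::nat) = \<one>\<^bsub>MW\<^esub>" using tk by (simp add: gs_def)
  qed simp
  then show ?thesis using quadratic_number_field_F elliptic_curve_over_F by blast
qed

theorem torsion_2_10_rank_4:
  "\<exists>K E. quadratic_number_field K \<and> elliptic_curve_over K E \<and>
     has_subgroup_isomorphic_to (mordell_weil_group E K) (integer_mod_group 2 \<times>\<times> integer_mod_group 10 \<times>\<times> free_abelian_group_of_rank 4)"
proof -
  interpret quadratic "55325286553" by unfold_locales (rule not_square_int[of 235213]; simp)
  \<comment> \<open>The curve and all the points below except \<open>gs ! 0\<close> are rational.
    The factor x^2 + a x + b has discriminant 2004552903125^2 D, so the field is the one over which
    the 2-torsion becomes full.\<close>
  define a b c where "a = mk 290781426181610857 0" and "b = mk (-34439004478440467537992443684716544) 0" and "c = mk 0 0"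
  interpret descent "55325286553" a b c
  proof unfold_locales
    show "discriminant (Weierstrass 0 a 0 b c) \<noteq> 0"
      by (simp add: discriminant_def Let_def a_def b_def c_def mk_simps)
  qed (auto simp: a_def b_def c_def mk_in_F intro: F_closed)
  interpret G: comm_group MW by (rule comm_group_MW)
  let ?t = "Affine (mk (-70049056694718816) 0) (mk (-59122964193080555565626400) 0)"
    and ?t2 = "Affine (mk 110719985698992384 0) (mk (-33299935298855763801120000) 0)"
    and ?t4 = "Affine (mk 491641231209283584 0) (mk 414956150449060531687833600 0)"
    and ?t8 = "Affine (mk 110719985698992384 0) (mk 33299935298855763801120000 0)"
  have d2: "?t \<otimes>\<^bsub>MW\<^esub> ?t = ?t2"
    by (rule double_eq[of _ "mk 511276147 0"]) (simp_all add: a_def b_def c_def mk_simps)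
  have d4: "?t2 \<otimes>\<^bsub>MW\<^esub> ?t2 = ?t4"
    by (rule double_eq[of _ "mk (-1001929453) 0"]) (simp_all add: a_def b_def c_def mk_simps)
  have d8: "?t4 \<otimes>\<^bsub>MW\<^esub> ?t4 = ?t8"
    by (rule double_eq[of _ "mk 1176768403 0"]) (simp_all add: a_def b_def c_def mk_simps)
  define gs where "gs = [Affine (mk (- 290781426181610857/2) (2004552903125/2)) 0, ?t,
    Affine (mk 184643872027152384 0) (mk 99246634505744847475200000 0),
    Affine (mk 107498575576623456 0) (mk 30005955604816776958904352 0),
    Affine (mk (-146473700982276096) 0) (mk (-90224525710605308271575040) 0),
    Affine (mk (- 15944056059698814288384/117649) 0) (mk (- 3499098553256696565858225831974400/40353607) 0)]"
  have carrier: "set gs \<subseteq> carrier MW"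
    unfolding carrier_MW gs_def by (simp add: K_zero mk_in_F a_def b_def c_def mk_simps)
  have t: "?t \<in> carrier MW" using carrier by (simp add: gs_def)
  have len: "length gs = 6" by (simp add: gs_def)
  note pow = doublings[OF t d2 d4 d8 refl]
  have tk: "?t [^]\<^bsub>MW\<^esub> (10::nat) = \<one>\<^bsub>MW\<^esub>"
  proof -
    have "?t [^]\<^bsub>MW\<^esub> (10::nat) = ?t2 \<otimes>\<^bsub>MW\<^esub> ?t8"
      using nat_pow_split[OF G.monoid_axioms t, of 10 2 8] unfolding pow by simp
    also have "\<dots> = \<one>\<^bsub>MW\<^esub>"
      using opposite_eq_one[of "mk 110719985698992384 0" "mk (-33299935298855763801120000) 0"] by (simp add: mk_minus)
    finally show ?thesis .
  qed
  have tm: "?t [^]\<^bsub>MW\<^esub> (5::nat) \<noteq> \<one>\<^bsub>MW\<^esub>"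
  proof
    assume "?t [^]\<^bsub>MW\<^esub> (5::nat) = \<one>\<^bsub>MW\<^esub>"
    then have "?t4 \<otimes>\<^bsub>MW\<^esub> ?t = \<one>\<^bsub>MW\<^esub>"
      using nat_pow_split[OF G.monoid_axioms t, of 5 4 1] t unfolding pow by simp
    from mult_eq_one_imp_same_x[OF this] show False by (simp add: mk_eq_iff)
  qed
  have tr: "?t [^]\<^bsub>MW\<^esub> (2::nat) \<noteq> \<one>\<^bsub>MW\<^esub>" unfolding pow one_MW by simp
  \<comment> \<open>Descent maps at two of the roots, 0 and that of \<open>gs ! 0\<close>. The N
    clear the denominators 2 and powers of 7; the first value in \<open>v1\<close> is four times the
    derivative of the cubic at its root.\<close>
  have v0: "kummer_values (mk 0 0) gs [(2, -581562852363221714, 4009105806250), (1, -70049056694718816, 0), (1, 184643872027152384, 0), (1, 107498575576623456, 0), (1, -146473700982276096, 0), (343, -15944056059698814288384, 0)]"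
    unfolding kummer_values_def gs_def kummer_def by (simp add: K_zero mk_in_F a_def b_def c_def mk_simps)
  have v1: "kummer_values (mk (- 290781426181610857/2) (2004552903125/2)) gs [(2, 444619711451946948272072884238281250, -1165773504054351853776738456250), (2, 301366625584346450, -4009105806250), (2, 1320138340471831250, -4009105806250), (2, 1011557154669715538, -4009105806250), (2, -4331951565882670, -4009105806250), (235298, 546369459522090104257125650, -55491184883502910806250)]"
    unfolding kummer_values_def gs_def kummer_def by (simp add: K_zero mk_in_F a_def b_def c_def mk_simps)
  \<comment> \<open>Six split primes, one for each point; each symbol, composed with one of the two
    descent maps, is nontrivial on its own point only.\<close>
  have pl239: "place (55325286553) 239 25" by unfold_locales (simp_all add: cong_def)
  have pl191: "place (55325286553) 191 72" by unfold_locales (simp_all add: cong_def)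
  have pl103: "place (55325286553) 103 91" by unfold_locales (simp_all add: cong_def)
  have pl631: "place (55325286553) 631 211" by unfold_locales (simp_all add: cong_def)
  have pl29: "place (55325286553) 29 16" by unfold_locales (simp_all add: cong_def)
  have pl157: "place (55325286553) 157 87" by unfold_locales (simp_all add: cong_def)
  have c0: "character 239 25 0 [(2, -581562852363221714, 4009105806250), (1, -70049056694718816, 0), (1, 184643872027152384, 0), (1, 107498575576623456, 0), (1, -146473700982276096, 0), (343, -15944056059698814288384, 0)]" by code_simp
  have c1: "character 191 72 1 [(2, 444619711451946948272072884238281250, -1165773504054351853776738456250), (2, 301366625584346450, -4009105806250), (2, 1320138340471831250, -4009105806250), (2, 1011557154669715538, -4009105806250), (2, -4331951565882670, -4009105806250), (235298, 546369459522090104257125650, -55491184883502910806250)]" by code_simp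
  have c2: "character 103 91 2 [(2, -581562852363221714, 4009105806250), (1, -70049056694718816, 0), (1, 184643872027152384, 0), (1, 107498575576623456, 0), (1, -146473700982276096, 0), (343, -15944056059698814288384, 0)]" by code_simp
  have c3: "character 631 211 3 [(2, 444619711451946948272072884238281250, -1165773504054351853776738456250), (2, 301366625584346450, -4009105806250), (2, 1320138340471831250, -4009105806250), (2, 1011557154669715538, -4009105806250), (2, -4331951565882670, -4009105806250), (235298, 546369459522090104257125650, -55491184883502910806250)]" by code_simp
  have c4: "character 29 16 4 [(2, 444619711451946948272072884238281250, -1165773504054351853776738456250), (2, 301366625584346450, -4009105806250), (2, 1320138340471831250, -4009105806250), (2, 1011557154669715538, -4009105806250), (2, -4331951565882670, -4009105806250), (235298, 546369459522090104257125650, -55491184883502910806250)]" by code_simp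
  have c5: "character 157 87 5 [(2, -581562852363221714, 4009105806250), (1, -70049056694718816, 0), (1, 184643872027152384, 0), (1, 107498575576623456, 0), (1, -146473700982276096, 0), (343, -15944056059698814288384, 0)]" by code_simp
  have ev: "even (n k)" if sq: "G.combination (length gs) ((!) gs) n \<in> G.squares" and "k < length gs" for n k
  proof -
    have dis: "k = 0 \<or> k = 1 \<or> k = 2 \<or> k = 3 \<or> k = 4 \<or> k = 5" using \<open>k < length gs\<close> len by linarith
    have "even (n 0)" "even (n 1)" "even (n 2)" "even (n 3)" "even (n 4)" "even (n 5)"
      using even_exponent_if_character[OF pl239 v0 c0 carrier _ sq]
        even_exponent_if_character[OF pl191 v1 c1 carrier _ sq]
        even_exponent_if_character[OF pl103 v0 c2 carrier _ sq]
        even_exponent_if_character[OF pl631 v1 c3 carrier _ sq]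
        even_exponent_if_character[OF pl29 v1 c4 carrier _ sq]
        even_exponent_if_character[OF pl157 v0 c5 carrier _ sq]
      by (simp_all add: len)
    then show ?thesis using dis by auto
  qed
  have "has_subgroup_isomorphic_to MW
      (integer_mod_group 2 \<times>\<times> integer_mod_group (2 * 5) \<times>\<times> free_abelian_group_of_rank 4)"
  proof (rule has_subgroup_if_full_two_torsion[of gs 4 "mk (- 290781426181610857/2) (2004552903125/2)" "mk 0 0" "mk (- 290781426181610857/2) (- 2004552903125/2)"])
    fix q :: nat assume "prime q" "q dvd 2 * 5"
    then have "q = 2 \<or> q = 5" using prime_dvd_10[of q] by simp
    then show "gs ! 1 [^]\<^bsub>MW\<^esub> (2 * 5 div q) \<noteq> \<one>\<^bsub>MW\<^esub>" using tm tr by (auto simp: gs_def)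
  next
    show "set gs \<subseteq> carrier MW" by (rule carrier)
    show "length gs = Suc (Suc 4)" by (simp add: len)
    show "gs ! 0 = Affine (mk (- 290781426181610857/2) (2004552903125/2)) 0" by (simp add: gs_def)
    show "a = - ((mk (- 290781426181610857/2) (2004552903125/2)) + (mk 0 0) + (mk (- 290781426181610857/2) (- 2004552903125/2)))" by (simp add: a_def mk_simps)
    show "b = (mk (- 290781426181610857/2) (2004552903125/2)) * (mk 0 0) + (mk (- 290781426181610857/2) (2004552903125/2)) * (mk (- 290781426181610857/2) (- 2004552903125/2)) + (mk 0 0) * (mk (- 290781426181610857/2) (- 2004552903125/2))" by (simp add: b_def mk_simps)
    show "c = - ((mk (- 290781426181610857/2) (2004552903125/2)) * (mk 0 0) * (mk (- 290781426181610857/2) (- 2004552903125/2)))" by (simp add: c_def mk_simps)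
    show "even (n k)" if "G.combination (length gs) ((!) gs) n \<in> G.squares" "k < length gs" for n k by (rule ev[OF that])
    show "gs ! 1 [^]\<^bsub>MW\<^esub> (2 * 5 :: nat) = \<one>\<^bsub>MW\<^esub>" using tk by (simp add: gs_def)
  qed simp
  then have "has_subgroup_isomorphic_to MW
      (integer_mod_group 2 \<times>\<times> integer_mod_group 10 \<times>\<times> free_abelian_group_of_rank 4)" by simp
  then show ?thesis using quadratic_number_field_F elliptic_curve_over_F by blast
qed

theorem torsion_2_12_rank_4:
  "\<exists>K E. quadratic_number_field K \<and> elliptic_curve_over K E \<and>
     has_subgroup_isomorphic_to (mordell_weil_group E K) (integer_mod_group 2 \<times>\<times> integer_mod_group 12 \<times>\<times> free_abelian_group_of_rank 4)"
proof -
  interpret quadratic "18249" by unfold_locales (rule not_square_int[of 135]; simp)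
  define a b c where "a = mk 11459246881 0" and "b = mk (-19643578253312000000) 0" and "c = mk 0 0"
  interpret descent "18249" a b c
  proof unfold_locales
    show "discriminant (Weierstrass 0 a 0 b c) \<noteq> 0"
      by (simp add: discriminant_def Let_def a_def b_def c_def mk_simps)
  qed (auto simp: a_def b_def c_def mk_in_F intro: F_closed)
  interpret G: comm_group MW by (rule comm_group_MW)
  \<comment> \<open>Here the 2-torsion is already rational, and so is \<open>?t2\<close>, of order
    6. Over the quadratic field it is halved by \<open>?t\<close>, of order 12.\<close>
  let ?t = "Affine (mk (-4527297200) 46899600) (mk (-310681100545200) 1643408883600)"
    and ?t2 = "Affine (mk 16692640000 0) (mk 2741615886240000 0)"
    and ?t4 = "Affine (mk 2959360000 0) (mk 261042186240000 0)"
    and ?t8 = "Affine (mk 2959360000 0) (mk (-261042186240000) 0)"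
  have d2: "?t \<otimes>\<^bsub>MW\<^esub> ?t = ?t2"
    by (rule double_eq[of _ "mk (-129200) (-363)"]) (simp_all add: a_def b_def c_def mk_simps)
  have d4: "?t2 \<otimes>\<^bsub>MW\<^esub> ?t2 = ?t4"
    by (rule double_eq[of _ "mk 218641 0"]) (simp_all add: a_def b_def c_def mk_simps)
  have d8: "?t4 \<otimes>\<^bsub>MW\<^esub> ?t4 = ?t8"
    by (rule double_eq[of _ "mk 142609 0"]) (simp_all add: a_def b_def c_def mk_simps)
  define gs where "gs = [Affine (mk (-12973390625) 0) 0, ?t,
    Affine (mk 1945600000 0) (mk 111908966400000 0),
    Affine (mk (-107494400) 0) (mk 47357625369600 0),
    Affine (mk (- 124891696800/11) 0) (mk 0 (435707041442400/121)),
    Affine (mk (- 1993441974860720/312481) (14260429362960/312481)) (mk (18017710257187688659920/174676879) (- 222307416246842728560/174676879))]"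
  have carrier: "set gs \<subseteq> carrier MW"
    unfolding carrier_MW gs_def by (simp add: K_zero mk_in_F a_def b_def c_def mk_simps)
  have t: "?t \<in> carrier MW" using carrier by (simp add: gs_def)
  have len: "length gs = 6" by (simp add: gs_def)
  note pow = doublings[OF t d2 d4 d8 refl]
  have tk: "?t [^]\<^bsub>MW\<^esub> (12::nat) = \<one>\<^bsub>MW\<^esub>"
  proof -
    \<comment> \<open>The third doubling gives 8 t = -4 t.\<close>
    have "?t [^]\<^bsub>MW\<^esub> (12::nat) = ?t4 \<otimes>\<^bsub>MW\<^esub> ?t8"
      using nat_pow_split[OF G.monoid_axioms t, of 12 4 8] unfolding pow by simp
    also have "\<dots> = \<one>\<^bsub>MW\<^esub>"
      using opposite_eq_one[of "mk 2959360000 0" "mk 261042186240000 0"] by (simp add: mk_minus)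
    finally show ?thesis .
  qed
  have tm: "?t [^]\<^bsub>MW\<^esub> (6::nat) \<noteq> \<one>\<^bsub>MW\<^esub>"
  proof
    assume "?t [^]\<^bsub>MW\<^esub> (6::nat) = \<one>\<^bsub>MW\<^esub>"
    then have "?t4 \<otimes>\<^bsub>MW\<^esub> ?t2 = \<one>\<^bsub>MW\<^esub>"
      using nat_pow_split[OF G.monoid_axioms t, of 6 4 2] t unfolding pow by simp
    from mult_eq_one_imp_same_x[OF this] show False by (simp add: mk_eq_iff)
  qed
  have tr: "?t [^]\<^bsub>MW\<^esub> (4::nat) \<noteq> \<one>\<^bsub>MW\<^esub>" unfolding pow one_MW by simp
  have v0: "kummer_values (mk 0 0) gs [(1, -12973390625, 0), (1, -4527297200, 46899600), (1, 1945600000, 0), (1, -107494400, 0), (11, -1373808664800, 0), (559, -1993441974860720, 14260429362960)]"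
    unfolding kummer_values_def gs_def kummer_def by (simp add: K_zero mk_in_F a_def b_def c_def mk_simps)
  have v1: "kummer_values (mk (-12973390625) 0) gs [(1, 187952442562149890625, 0), (1, 8446093425, 46899600), (1, 14918990625, 0), (1, 12865896225, 0), (11, 195971600825, 0), (559, 2060496101029905, 14260429362960)]"
    unfolding kummer_values_def gs_def kummer_def by (simp add: K_zero mk_in_F a_def b_def c_def mk_simps)
  have pl113: "place (18249) 113 100" by unfold_locales (simp_all add: cong_def)
  have pl127: "place (18249) 127 71" by unfold_locales (simp_all add: cong_def)
  have pl229: "place (18249) 229 171" by unfold_locales (simp_all add: cong_def)
  have pl257: "place (18249) 257 60" by unfold_locales (simp_all add: cong_def)
  have pl157: "place (18249) 157 115" by unfold_locales (simp_all add: cong_def)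
  have pl373: "place (18249) 373 128" by unfold_locales (simp_all add: cong_def)
  have c0: "character 113 100 0 [(1, -12973390625, 0), (1, -4527297200, 46899600), (1, 1945600000, 0), (1, -107494400, 0), (11, -1373808664800, 0), (559, -1993441974860720, 14260429362960)]" by code_simp
  have c1: "character 127 71 1 [(1, 187952442562149890625, 0), (1, 8446093425, 46899600), (1, 14918990625, 0), (1, 12865896225, 0), (11, 195971600825, 0), (559, 2060496101029905, 14260429362960)]" by code_simp
  have c2: "character 229 171 2 [(1, 187952442562149890625, 0), (1, 8446093425, 46899600), (1, 14918990625, 0), (1, 12865896225, 0), (11, 195971600825, 0), (559, 2060496101029905, 14260429362960)]" by code_simp
  have c3: "character 257 60 3 [(1, -12973390625, 0), (1, -4527297200, 46899600), (1, 1945600000, 0), (1, -107494400, 0), (11, -1373808664800, 0), (559, -1993441974860720, 14260429362960)]" by code_simp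
  have c4: "character 157 115 4 [(1, -12973390625, 0), (1, -4527297200, 46899600), (1, 1945600000, 0), (1, -107494400, 0), (11, -1373808664800, 0), (559, -1993441974860720, 14260429362960)]" by code_simp
  have c5: "character 373 128 5 [(1, 187952442562149890625, 0), (1, 8446093425, 46899600), (1, 14918990625, 0), (1, 12865896225, 0), (11, 195971600825, 0), (559, 2060496101029905, 14260429362960)]" by code_simp
  have ev: "even (n k)" if sq: "G.combination (length gs) ((!) gs) n \<in> G.squares" and "k < length gs" for n k
  proof -
    have dis: "k = 0 \<or> k = 1 \<or> k = 2 \<or> k = 3 \<or> k = 4 \<or> k = 5" using \<open>k < length gs\<close> len by linarith
    have "even (n 0)" "even (n 1)" "even (n 2)" "even (n 3)" "even (n 4)" "even (n 5)"
      using even_exponent_if_character[OF pl113 v0 c0 carrier _ sq]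
        even_exponent_if_character[OF pl127 v1 c1 carrier _ sq]
        even_exponent_if_character[OF pl229 v1 c2 carrier _ sq]
        even_exponent_if_character[OF pl257 v0 c3 carrier _ sq]
        even_exponent_if_character[OF pl157 v0 c4 carrier _ sq]
        even_exponent_if_character[OF pl373 v1 c5 carrier _ sq]
      by (simp_all add: len)
    then show ?thesis using dis by auto
  qed
  have "has_subgroup_isomorphic_to MW
      (integer_mod_group 2 \<times>\<times> integer_mod_group (2 * 6) \<times>\<times> free_abelian_group_of_rank 4)"
  proof (rule has_subgroup_if_full_two_torsion[of gs 4 "mk (-12973390625) 0" "mk 0 0" "mk 1514143744 0"])
    fix q :: nat assume "prime q" "q dvd 2 * 6"
    then have "q = 2 \<or> q = 3" using prime_dvd_12[of q] by simp
    then show "gs ! 1 [^]\<^bsub>MW\<^esub> (2 * 6 div q) \<noteq> \<one>\<^bsub>MW\<^esub>" using tm tr by (auto simp: gs_def)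
  next
    show "set gs \<subseteq> carrier MW" by (rule carrier)
    show "length gs = Suc (Suc 4)" by (simp add: len)
    show "gs ! 0 = Affine (mk (-12973390625) 0) 0" by (simp add: gs_def)
    show "a = - ((mk (-12973390625) 0) + (mk 0 0) + (mk 1514143744 0))" by (simp add: a_def mk_simps)
    show "b = (mk (-12973390625) 0) * (mk 0 0) + (mk (-12973390625) 0) * (mk 1514143744 0) + (mk 0 0) * (mk 1514143744 0)" by (simp add: b_def mk_simps)
    show "c = - ((mk (-12973390625) 0) * (mk 0 0) * (mk 1514143744 0))" by (simp add: c_def mk_simps)
    show "even (n k)" if "G.combination (length gs) ((!) gs) n \<in> G.squares" "k < length gs" for n k by (rule ev[OF that])
    show "gs ! 1 [^]\<^bsub>MW\<^esub> (2 * 6 :: nat) = \<one>\<^bsub>MW\<^esub>" using tk by (simp add: gs_def)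
  qed simp
  then have "has_subgroup_isomorphic_to MW
      (integer_mod_group 2 \<times>\<times> integer_mod_group 12 \<times>\<times> free_abelian_group_of_rank 4)" by simp
  then show ?thesis using quadratic_number_field_F elliptic_curve_over_F by blast
qed

theorem theorem3p2:
  shows
    "(\<exists>K E. quadratic_number_field K \<and> elliptic_curve_over K E \<and>
        has_subgroup_isomorphic_to (mordell_weil_group E K)
          (integer_mod_group 15 \<times>\<times> integer_group)) \<and>
     (\<exists>K E. quadratic_number_field K \<and> elliptic_curve_over K E \<and>
        has_subgroup_isomorphic_to (mordell_weil_group E K)
          (integer_mod_group 18 \<times>\<times> free_abelian_group_of_rank 2)) \<and>
     (\<exists>K E. quadratic_number_field K \<and> elliptic_curve_over K E \<and>
        has_subgroup_isomorphic_to (mordell_weil_group E K)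
          (integer_mod_group 2 \<times>\<times> integer_mod_group 10 \<times>\<times> free_abelian_group_of_rank 4)) \<and>
     (\<exists>K E. quadratic_number_field K \<and> elliptic_curve_over K E \<and>
        has_subgroup_isomorphic_to (mordell_weil_group E K)
          (integer_mod_group 2 \<times>\<times> integer_mod_group 12 \<times>\<times> free_abelian_group_of_rank 4))"
  by (intro conjI torsion_15_rank_1 torsion_18_rank_2 torsion_2_10_rank_4 torsion_2_12_rank_4)

end
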